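(* Let $0\le l\le n$ be integers, let $(\nu)=(\nu_1,\dots,\nu_n)\in\{0,1\}^n$ satisfy $\sharp\{i\mid \nu_i=0\}=l$, and write $\{i\mid\nu_i=0\}=\{k_1<\cdots<k_l\}$. For $(\mu)=(\mu_1,\dots,\mu_l)\in\{+,-\}^l$ let $$G^{(\nu)}_{(\mu)}(t,z)=\sum_{\epsilon_1,\dots,\epsilon_l=\pm}\ \prod_{j=1}^l\epsilon_j\int_{C^l}\prod_{j=1}^l\frac{du_j}{2\pi i\,u_j}\;G^{(\nu)}_{(\epsilon)(\mu)}(t,z|u),$$ where the integrand $G^{(\nu)}_{(\epsilon)(\mu)}(t,z|u)$ and the contour $C^l$ are those defined in the context. Then: (1) if $(\mu)\neq(-^l)=(-,\dots,-)$, then $G^{(\nu)}_{(\mu)}(t,z)=0$; (2) for $(\mu)=(-^l)$, $$G^{(\nu)}_{(-^l)}(t,z)=q^{-2l+\frac12 l(l-1)-\sum_{i=1}^l k_i}\,(q-q^{-1})^l\; w_{(-\nu)}(t,z),$$ where $(-\nu)=(1-\nu_1,\dots,1-\nu_n)$ and $w_{(-\nu)}$ is the function defined in the context.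
   Context: Parameters: $q$ is a complex number with $|q|<1$, and $k$ is a complex number such that $p=q^{2(k+2)}$ satisfies $|p|<1$. $z=(z_1,\dots,z_n)$ and $t=(t_1,\dots,t_l)$ are complex variables, and $u=(u_1,\dots,u_l)$ are integration variables. Signs $\pm$ are identified with $\pm1$ wherever they appear in exponents or products. Indices $a,b$ of $t$ run over $1,\dots,l$; indices of $z$ run over $1,\dots,n$; indices of $u,\mu,k$ run over $1,\dots,l$. Integrand. For $(\epsilon)=(\epsilon_1,\dots,\epsilon_l)\in\{+,-\}^l$ and $(\mu)=(\mu_1,\dots,\mu_l)\in\{+,-\}^l$, $$G^{(\nu)}_{(\epsilon)(\mu)}(t,z|u)=\widehat G^{(\nu)}_{(\epsilon)(\mu)}(t,z|u)\prod_{1\le a<b\le l}\frac{q^{\epsilon_b}t_b-q^{\epsilon_a}t_a}{t_b-q^{-2}t_a},$$ $$\widehat G^{(\nu)}_{(\epsilon)(\mu)}(t,z|u)=\prod_{i=1}^l\frac{u_i(z_{k_i}-q^{\mu_i-2-k}u_i)}{(z_{k_i}-q^{-1-k}u_i)(u_i-q^{k+3}z_{k_i})}\ \prod_{j=1}^l\prod_{1\le i<k_j}\frac{z_i-q^{\mu_j-2-k}u_j}{z_i-q^{-1-k}u_j}\ \prod_{j=1}^l\prod_{k_j<i\le n}\frac{u_j-q^{k+2-\mu_j}z_i}{u_j-q^{k+3}z_i}$$ $$\qquad\times\prod_{1\le i<j\le l}\frac{u_i-q^{\mu_i-\mu_j}u_j}{u_i-q^{-2}u_j}\ \prod_{i=1}^l\prod_{a=1}^l\frac{u_i-q^{-\mu_i(k+1)-\epsilon_a}t_a}{u_i-q^{-\mu_i(k+2)}t_a}.$$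 Contour. $C^l$ is a suitable deformation of the torus $\{(u_1,\dots,u_l)\mid |u_i|=1,\ 1\le i\le l\}$ specified as follows. The contour for the integration variable $u_i$ is a simple closed curve rounding the origin in the counterclockwise direction such that $q^{k+3}z_j$ $(1\le j\le n)$, $q^{-2}u_j$ $(i<j)$, $q^{-\mu_i(k+2)}t_a$ $(1\le a\le l)$ are inside and $q^{k+1}z_j$ $(1\le j\le n)$, $q^{2}u_j$ $(j<i)$ are outside. The function $w$. For $(\eta)=(\eta_1,\dots,\eta_n)\in\{0,1\}^n$ with $\{i\mid\eta_i=1\}=\{k_1<\cdots<k_l\}$, $$w_{(\eta)}(t,z)=\prod_{1\le a<b\le l}\frac{t_a-t_b}{q^{-2}t_a-t_b}\ \sum_{\substack{1\le a_1,\dots,a_l\le l\\ a_i\ne a_j\,(i\ne j)}}\ \prod_{i=1}^l\left(\frac{t_{a_i}}{t_{a_i}-q^{-1}z_{k_i}}\prod_{1\le j<k_i}\frac{q^{-1}t_{a_i}-z_j}{t_{a_i}-q^{-1}z_j}\prod_{i<j\le l}\frac{q^{-2}t_{a_i}-t_{a_j}}{t_{a_i}-t_{a_j}}\right).$$ For $(\eta)=(-\nu)$ the indices $k_i$ are the same as those defined from $\{i\mid\nu_i=0\}$.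
   Formalization: For l≥2 the contour's inside/outside list is contradictory; sides are prescribed only for points that remain poles for the given (μ), the cancelled ones being merely avoided, on products of fixed curves. Also q≠0, t_b≠q^{-2}t_a (a<b) and, in (2), distinct t_a are assumed so that denominators are nonzero. *)

theory Defs
  imports "HOL-Complex_Analysis.Complex_Analysis"
begin

text \<open>
  Tuples are functions on \<open>nat\<close>, of which only the values at the indices \<open>1, 2, \<dots>\<close>
  occurring in the formulas matter. Signs are the integers \<open>1\<close> and \<open>-1\<close>.
  All quantities depend on the complex number \<open>k\<close> only through \<open>q powr k\<close>, which takes every
  nonzero value as \<open>k\<close> varies (for \<open>0 < norm q < 1\<close>), so using the principal branch in \<open>powr\<close>
  loses no generality.
\<close>

text \<open>The \<open>i\<close>-th smallest element of a finite set, counted from \<open>1\<close>.\<close>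
definition kth :: "nat set \<Rightarrow> nat \<Rightarrow> nat" where
  "kth A i = sorted_list_of_set A ! (i - 1)"

definition level_set :: "nat \<Rightarrow> (nat \<Rightarrow> nat) \<Rightarrow> nat \<Rightarrow> nat set" where
  "level_set n \<nu> c = {i \<in> {1..n}. \<nu> i = c}"

definition G_hat ::
  "complex \<Rightarrow> complex \<Rightarrow> nat \<Rightarrow> nat \<Rightarrow> (nat \<Rightarrow> nat) \<Rightarrow> (nat \<Rightarrow> int) \<Rightarrow> (nat \<Rightarrow> int)
     \<Rightarrow> (nat \<Rightarrow> complex) \<Rightarrow> (nat \<Rightarrow> complex) \<Rightarrow> (nat \<Rightarrow> complex) \<Rightarrow> complex" where
  "G_hat q k n l \<nu> \<epsilon> \<mu> t z u =
    (let \<kappa> = kth (level_set n \<nu> 0) in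
      (\<Prod>i\<in>{1..l}. u i * (z (\<kappa> i) - q powr (of_int (\<mu> i) - 2 - k) * u i)
          / ((z (\<kappa> i) - q powr (-1 - k) * u i) * (u i - q powr (k + 3) * z (\<kappa> i))))
    * (\<Prod>j\<in>{1..l}. \<Prod>i\<in>{1..<\<kappa> j}.
          (z i - q powr (of_int (\<mu> j) - 2 - k) * u j) / (z i - q powr (-1 - k) * u j))
    * (\<Prod>j\<in>{1..l}. \<Prod>i\<in>{\<kappa> j<..n}.
          (u j - q powr (k + 2 - of_int (\<mu> j)) * z i) / (u j - q powr (k + 3) * z i))
    * (\<Prod>i\<in>{1..l}. \<Prod>j\<in>{i<..l}.
          (u i - q powr (of_int (\<mu> i) - of_int (\<mu> j)) * u j) / (u i - q powr (-2) * u j))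
    * (\<Prod>i\<in>{1..l}. \<Prod>a\<in>{1..l}.
          (u i - q powr (- of_int (\<mu> i) * (k + 1) - of_int (\<epsilon> a)) * t a)
            / (u i - q powr (- of_int (\<mu> i) * (k + 2)) * t a)))"

definition G_integrand ::
  "complex \<Rightarrow> complex \<Rightarrow> nat \<Rightarrow> nat \<Rightarrow> (nat \<Rightarrow> nat) \<Rightarrow> (nat \<Rightarrow> int) \<Rightarrow> (nat \<Rightarrow> int)
     \<Rightarrow> (nat \<Rightarrow> complex) \<Rightarrow> (nat \<Rightarrow> complex) \<Rightarrow> (nat \<Rightarrow> complex) \<Rightarrow> complex" where
  "G_integrand q k n l \<nu> \<epsilon> \<mu> t z u =
     G_hat q k n l \<nu> \<epsilon> \<mu> t z u
     * (\<Prod>a\<in>{1..l}. \<Prod>b\<in>{a<..l}.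
          (q powr of_int (\<epsilon> b) * t b - q powr of_int (\<epsilon> a) * t a) / (t b - q powr (-2) * t a))"

text \<open>
  The integral over \<open>\<gamma> 1 \<times> \<dots> \<times> \<gamma> l\<close> of \<open>F u\<close> with respect to \<open>du\<^sub>1 \<dots> du\<^sub>l\<close>, as an iterated
  contour integral (\<open>u l\<close> outermost). The components of \<open>u\<close> beyond \<open>l\<close> are those of the
  initial argument.
\<close>
primrec multi_contour_integral ::
  "(nat \<Rightarrow> real \<Rightarrow> complex) \<Rightarrow> nat \<Rightarrow> ((nat \<Rightarrow> complex) \<Rightarrow> complex) \<Rightarrow> (nat \<Rightarrow> complex) \<Rightarrow> complex"
where
  "multi_contour_integral \<gamma> 0 F u = F u"
| "multi_contour_integral \<gamma> (Suc m) F u =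
     contour_integral (\<gamma> (Suc m)) (\<lambda>w. multi_contour_integral \<gamma> m F (u(Suc m := w)))"

definition ccw_around_origin :: "(real \<Rightarrow> complex) \<Rightarrow> bool" where
  "ccw_around_origin g \<longleftrightarrow>
     valid_path g \<and> simple_path g \<and> pathfinish g = pathstart g \<and>
     0 \<in> inside (path_image g) \<and> winding_number g 0 = 1"

text \<open>
  The cycle \<open>\<gamma> 1 \<times> \<dots> \<times> \<gamma> l\<close>. No \<open>u\<close> on the cycle meets a hyperplane
  \<open>u i = q powr (k+3) * z j\<close>, \<open>u i = q powr (k+1) * z j\<close>, \<open>u i = q powr (-2) * u j\<close> (\<open>i < j\<close>)
  or \<open>u i = q powr (-\<mu> i * (k+2)) * t a\<close>, and these lie on the prescribed side of the contour
  of \<open>u i\<close>.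

  The side is prescribed only where the displayed denominator is not cancelled for the given
  signs: in \<open>G_hat\<close>, if \<open>\<mu> i = -1\<close> then all the factors \<open>u i - q powr (k+3) * z j\<close> cancel, if
  \<open>\<mu> i = 1\<close> then all the factors \<open>z j - q powr (-1-k) * u i\<close> cancel, and if \<open>\<mu> i = -1\<close>,
  \<open>\<mu> j = 1\<close> (\<open>i < j\<close>) then \<open>u i - q powr (-2) * u j\<close> cancels. Prescribing the sides of these
  spurious points as well would be contradictory when \<open>2 \<le> l\<close>: \<open>q powr (k+3) * z m\<close> inside
  \<open>\<gamma> j\<close> and \<open>q powr (-2) * \<gamma> j\<close> inside \<open>\<gamma> i\<close> force \<open>q powr (k+1) * z m\<close> inside \<open>\<gamma> i\<close>.
\<close>
definition admissible_contours ::
  "complex \<Rightarrow> complex \<Rightarrow> nat \<Rightarrow> nat \<Rightarrow> (nat \<Rightarrow> int) \<Rightarrow> (nat \<Rightarrow> complex) \<Rightarrow> (nat \<Rightarrow> complex)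
     \<Rightarrow> (nat \<Rightarrow> real \<Rightarrow> complex) \<Rightarrow> bool" where
  "admissible_contours q k n l \<mu> t z \<gamma> \<longleftrightarrow>
     (\<forall>i\<in>{1..l}. ccw_around_origin (\<gamma> i)) \<and>
     (\<forall>i\<in>{1..l}. \<forall>j\<in>{1..n}.
        q powr (k + 3) * z j \<notin> path_image (\<gamma> i) \<and>
        q powr (k + 1) * z j \<notin> path_image (\<gamma> i) \<and>
        (\<mu> i = 1 \<longrightarrow> q powr (k + 3) * z j \<in> inside (path_image (\<gamma> i))) \<and>
        (\<mu> i = -1 \<longrightarrow> q powr (k + 1) * z j \<in> outside (path_image (\<gamma> i)))) \<and>
     (\<forall>i\<in>{1..l}. \<forall>a\<in>{1..l}.
        q powr (- of_int (\<mu> i) * (k + 2)) * t a \<in> inside (path_image (\<gamma> i))) \<and>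
     (\<forall>i\<in>{1..l}. \<forall>j\<in>{i<..l}.
        (\<forall>v\<in>path_image (\<gamma> j). q powr (-2) * v \<notin> path_image (\<gamma> i)) \<and>
        (\<not> (\<mu> i = -1 \<and> \<mu> j = 1) \<longrightarrow>
           (\<forall>v\<in>path_image (\<gamma> j). q powr (-2) * v \<in> inside (path_image (\<gamma> i))) \<and>
           (\<forall>v\<in>path_image (\<gamma> i). q powr 2 * v \<in> outside (path_image (\<gamma> j)))))"

definition G ::
  "complex \<Rightarrow> complex \<Rightarrow> nat \<Rightarrow> nat \<Rightarrow> (nat \<Rightarrow> nat) \<Rightarrow> (nat \<Rightarrow> int) \<Rightarrow> (nat \<Rightarrow> real \<Rightarrow> complex)
     \<Rightarrow> (nat \<Rightarrow> complex) \<Rightarrow> (nat \<Rightarrow> complex) \<Rightarrow> complex" where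
  "G q k n l \<nu> \<mu> \<gamma> t z =
     (\<Sum>\<epsilon>\<in>{1..l} \<rightarrow>\<^sub>E {1, -1}.
        (\<Prod>j\<in>{1..l}. of_int (\<epsilon> j)) *
        multi_contour_integral \<gamma> l
          (\<lambda>u. (\<Prod>j\<in>{1..l}. 1 / (2 * of_real pi * \<i> * u j)) * G_integrand q k n l \<nu> \<epsilon> \<mu> t z u)
          (\<lambda>_. 0))"

definition w ::
  "complex \<Rightarrow> nat \<Rightarrow> nat \<Rightarrow> (nat \<Rightarrow> nat) \<Rightarrow> (nat \<Rightarrow> complex) \<Rightarrow> (nat \<Rightarrow> complex) \<Rightarrow> complex" where
  "w q n l \<eta> t z =
    (let \<kappa> = kth (level_set n \<eta> 1) in
      (\<Prod>a\<in>{1..l}. \<Prod>b\<in>{a<..l}. (t a - t b) / (q powr (-2) * t a - t b))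
    * (\<Sum>a\<in>{a \<in> {1..l} \<rightarrow>\<^sub>E {1..l}. inj_on a {1..l}}.
        \<Prod>i\<in>{1..l}.
          t (a i) / (t (a i) - q powr (-1) * z (\<kappa> i))
          * (\<Prod>j\<in>{1..<\<kappa> i}. (q powr (-1) * t (a i) - z j) / (t (a i) - q powr (-1) * z j))
          * (\<Prod>j\<in>{i<..l}. (q powr (-2) * t (a i) - t (a j)) / (t (a i) - t (a j)))))"

end

theory Submission
  imports Defs "Jordan_Normal_Form.Determinant"
begin

text \<open>
  A variable of sign \<open>1\<close> has all its poles inside its contour and is coupled trivially to the
  variables of sign \<open>-1\<close> of smaller index, so that integrating these variables out, innermost
  first, contributes only factors \<open>1\<close>. What is left is an integral over the variables of sign
  \<open>-1\<close>, in which \<open>\<epsilon>\<close> enters only through a Vandermonde product in the \<open>q^(\<epsilon> a) t a\<close> and the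
  values at the \<open>q^(-\<epsilon> a) t a\<close> of a polynomial \<open>P\<close> whose degree is the number of these variables.

  If this degree is less than \<open>l\<close>, the signed sum over \<open>\<epsilon>\<close> is a determinant that vanishes
  identically, because its matrix annihilates the coefficient vector of \<open>P\<close>.

  If all signs are \<open>-1\<close>, then, outermost variable first, the only poles inside the contour are the
  points \<open>q^(k+2) t a\<close> with \<open>\<epsilon> a = 1\<close>, and taking the residue at one of them leaves the same
  integral with one variable and this \<open>a\<close> removed. Hence only \<open>\<epsilon> = (1, \<dots>, 1)\<close> contributes, and
  its residues are indexed by the permutations in the definition of \<open>w\<close>.
\<close>

section \<open>Contour integrals depending on parameters\<close>

text \<open>The value 1 of the removed integrals is a residue at infinity: when all poles lie
  inside, only the behaviour 1 / (2 pi i v) of the integrand at infinity counts, so neither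
  \<epsilon> nor the outer variables matter.

  The null vector comes from an antisymmetry: for y = q^e t with weight \<alpha> = e P(q^(-e) t),
  the sum of \<alpha> P(y) over e = 1, -1 is P(q^(-1) t) P(q t) - P(q t) P(q^(-1) t).

  The residue recursion closes up because at u_m = q^(k+2) t_a the kernel (u_i - u_m) / (u_i -
  q^(-2) u_m) is the inverse of the factor of t_a with \<epsilon>_a = 1 in the variable u_i.

  The obstacle is analytic. The signed sum vanishes pointwise, so it has to be moved under the
  iterated integral, and additivity requires integrability at every level, since a non-integrable
  function has contour integral 0 by default. Inner integrals are therefore shown to be continuous,
  and holomorphic in each remaining variable; the same fact lets Cauchy's formula act on the
  outermost variable.\<close>

definition cont_holo :: "(nat \<Rightarrow> complex) set \<Rightarrow> ((nat \<Rightarrow> complex) \<Rightarrow> complex) \<Rightarrow> bool" where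
  "cont_holo \<Omega> F \<longleftrightarrow> continuous_on \<Omega> F \<and>
     (\<forall>u\<in>\<Omega>. \<forall>i. (\<lambda>w. F (u(i := w))) field_differentiable at (u i))"

lemma continuous_on_fun_upd:
  fixes f :: "'a::topological_space \<Rightarrow> nat \<Rightarrow> complex"
  assumes "continuous_on S f" "continuous_on S g"
  shows "continuous_on S (\<lambda>x. (f x)(i := g x))"
proof (rule continuous_on_coordinatewise_then_product)
  fix j
  show "continuous_on S (\<lambda>x. ((f x)(i := g x)) j)"
    using assms(2) continuous_on_product_then_coordinatewise[OF assms(1)] by (cases "j = i") auto
qed

lemmas continuous_on_fun_upd_intros =
  continuous_on_fun_upd continuous_on_fst continuous_on_snd continuous_on_id continuous_on_const

lemma open_slice:
  fixes u :: "nat \<Rightarrow> complex"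
  assumes "open \<Omega>"
  shows "open {w. u(i := w) \<in> \<Omega>}"
proof -
  have "continuous_on UNIV (\<lambda>w. u(i := w))"
    by (intro continuous_on_fun_upd_intros)
  then have "open ((\<lambda>w. u(i := w)) -` \<Omega>)"
    using assms open_vimage by blast
  then show ?thesis by (simp add: vimage_def)
qed

lemma cont_holo_slice:
  assumes "cont_holo \<Omega> F" "\<And>w. w \<in> S \<Longrightarrow> u(i := w) \<in> \<Omega>"
  shows "(\<lambda>w. F (u(i := w))) holomorphic_on S"
  unfolding holomorphic_on_def
proof
  fix w assume "w \<in> S"
  then have "(\<lambda>v. F ((u(i := w))(i := v))) field_differentiable at ((u(i := w)) i)"
    using assms unfolding cont_holo_def by blast
  then show "(\<lambda>w. F (u(i := w))) field_differentiable at w within S"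
    by (simp add: field_differentiable_at_within)
qed

lemma cont_holo_const: "cont_holo \<Omega> (\<lambda>_. c)"
  by (simp add: cont_holo_def)

lemma cont_holo_coord: "cont_holo \<Omega> (\<lambda>u. u j)"
  unfolding cont_holo_def
proof (intro conjI ballI allI)
  show "continuous_on \<Omega> (\<lambda>u. u j)"
    by (rule continuous_on_subset[OF continuous_on_product_coordinates]) simp
  fix u :: "nat \<Rightarrow> complex" and i
  show "(\<lambda>w. (u(i := w)) j) field_differentiable at (u i)"
    by (cases "i = j") auto
qed

lemma cont_holo_diff: "cont_holo \<Omega> F \<Longrightarrow> cont_holo \<Omega> H \<Longrightarrow> cont_holo \<Omega> (\<lambda>u. F u - H u)"
  unfolding cont_holo_def
  by (auto intro!: continuous_intros field_differentiable_diff)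

lemma cont_holo_mult: "cont_holo \<Omega> F \<Longrightarrow> cont_holo \<Omega> H \<Longrightarrow> cont_holo \<Omega> (\<lambda>u. F u * H u)"
  unfolding cont_holo_def
  by (auto intro!: continuous_intros field_differentiable_mult)

lemma cont_holo_divide:
  "cont_holo \<Omega> F \<Longrightarrow> cont_holo \<Omega> H \<Longrightarrow> (\<And>u. u \<in> \<Omega> \<Longrightarrow> H u \<noteq> 0) \<Longrightarrow> cont_holo \<Omega> (\<lambda>u. F u / H u)"
  unfolding cont_holo_def
  by (auto intro!: continuous_intros field_differentiable_divide)

lemma cont_holo_prod:
  "(\<And>s. s \<in> A \<Longrightarrow> cont_holo \<Omega> (F s)) \<Longrightarrow> cont_holo \<Omega> (\<lambda>u. \<Prod>s\<in>A. F s u)"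
  by (induction A rule: infinite_finite_induct) (auto intro: cont_holo_const cont_holo_mult)

text \<open>Exchanging contour integrals, and their continuous dependence on parameters, are
  available for paths whose derivative is continuous on the whole interval; polynomial paths are of
  this kind.\<close>

lemma polynomial_path_derivative:
  fixes p :: "real \<Rightarrow> complex"
  assumes "polynomial_function p"
  shows "continuous_on S (\<lambda>x. vector_derivative p (at x))"
proof -
  obtain p' where "polynomial_function p'" and d: "\<And>x. (p has_vector_derivative p' x) (at x)"
    using has_vector_derivative_polynomial_function[OF assms] by blast
  moreover have "(\<lambda>x. vector_derivative p (at x)) = p'"
    using d vector_derivative_at by blast
  ultimately show ?thesis
    using continuous_on_polymonial_function by auto
qed

lemma continuous_on_contour_integral_param:
  fixes f :: "'a::topological_space \<Rightarrow> complex \<Rightarrow> complex"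
  assumes f: "continuous_on (X \<times> path_image g) (\<lambda>(x, v). f x v)" and g: "path g"
    and g': "continuous_on {0..1} (\<lambda>x. vector_derivative g (at x))"
  shows "continuous_on X (\<lambda>x. contour_integral g (f x))"
proof -
  have c: "continuous_on {0..1} g"
    using g by (simp add: path_def)
  have "continuous_on (X \<times> {0..1}) (\<lambda>(x, s). f x (g s) * vector_derivative g (at s))"
  proof -
    have "continuous_on (X \<times> {0..1}) ((\<lambda>(x, v). f x v) \<circ> (\<lambda>(x, s). (x, g s)))"
      by (rule continuous_on_compose, unfold case_prod_beta)
         (use f in \<open>auto simp: path_image_def case_prod_beta intro!: continuous_intros continuous_on_compose2[OF c]
           elim!: continuous_on_subset\<close>)
    moreover have "continuous_on (X \<times> {0..1}) (\<lambda>y. vector_derivative g (at (snd y)))"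
      by (rule continuous_on_compose2[OF g']) (auto intro!: continuous_intros)
    ultimately show ?thesis
      by (auto simp: case_prod_beta o_def intro!: continuous_intros)
  qed
  then have "continuous_on X (\<lambda>x. integral (cbox 0 1) (\<lambda>s. f x (g s) * vector_derivative g (at s)))"
    using integral_continuous_on_param[of X 0 1 "\<lambda>x s. f x (g s) * vector_derivative g (at s)"] by simp
  then show ?thesis
    by (simp add: contour_integral_integral)
qed

lemma contour_integrable_continuous_C1:
  assumes "continuous_on (path_image g) f" "path g"
    and "continuous_on {0..1} (\<lambda>x. vector_derivative g (at x))"
  shows "f contour_integrable_on g"
proof -
  have "continuous_on {0..1} (\<lambda>x. f (g x) * vector_derivative g (at x))"
    using assms by (auto simp: path_def path_image_def intro!: continuous_intros continuous_on_compose2[OF assms(1)])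
  then show ?thesis
    unfolding contour_integrable_on using integrable_continuous_interval by blast
qed

text \<open>Compactness of \<open>C\<close> lets one pair of neighbourhoods serve all its points.
  The set \<open>U\<close> leaves room for deforming a contour, and \<open>N\<close> makes the same
  deformation valid for all nearby parameters.\<close>

lemma open_tube_slice:
  fixes u0 :: "nat \<Rightarrow> complex"
  assumes "open \<Omega>" "compact C" "\<And>v. v \<in> C \<Longrightarrow> u0(i := v) \<in> \<Omega>"
  obtains N U where "open N" "open U" "u0 \<in> N" "C \<subseteq> U" "\<And>u v. u \<in> N \<Longrightarrow> v \<in> U \<Longrightarrow> u(i := v) \<in> \<Omega>"
proof -
  define W where "W = (\<lambda>(u, v). u(i := v)) -` \<Omega>"
  have "continuous_on UNIV (\<lambda>y::(nat \<Rightarrow> complex) \<times> complex. (fst y)(i := snd y))"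
    by (intro continuous_on_fun_upd_intros)
  then have "open W"
    unfolding W_def case_prod_beta using assms(1) open_vimage by blast
  moreover have "{u0} \<times> C \<subseteq> W"
    using assms(3) by (auto simp: W_def)
  ultimately have "\<exists>N U. open N \<and> open U \<and> u0 \<in> N \<and> C \<subseteq> U \<and> N \<times> U \<subseteq> W"
    using tube_lemma_right[of euclidean euclidean W C u0] assms(2)
    by (simp add: open_openin[symmetric])
  then obtain N U where "open N" "open U" "u0 \<in> N" "C \<subseteq> U" "N \<times> U \<subseteq> W"
    by blast
  moreover from this have "u(i := v) \<in> \<Omega>" if "u \<in> N" "v \<in> U" for u v
    using that by (auto simp: W_def)
  ultimately show thesis using that by blast
qed

text \<open>The natural domain of the integral over coordinate \<open>i\<close>. The contour
  variable overwrites \<open>u i\<close>, so membership depends on the other coordinates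
  only.\<close>

definition reach1 :: "(real \<Rightarrow> complex) \<Rightarrow> nat \<Rightarrow> (nat \<Rightarrow> complex) set \<Rightarrow> (nat \<Rightarrow> complex) set" where
  "reach1 g i \<Omega> = {u. \<forall>v\<in>path_image g. u(i := v) \<in> \<Omega>}"

lemma open_reach1:
  assumes "path g" "open \<Omega>"
  shows "open (reach1 g i \<Omega>)"
proof (subst open_subopen, intro ballI)
  fix u0 assume "u0 \<in> reach1 g i \<Omega>"
  then have "\<And>v. v \<in> path_image g \<Longrightarrow> u0(i := v) \<in> \<Omega>"
    by (simp add: reach1_def)
  then obtain N U where "open N" "open U" "u0 \<in> N" "path_image g \<subseteq> U"
    "\<And>u v. u \<in> N \<Longrightarrow> v \<in> U \<Longrightarrow> u(i := v) \<in> \<Omega>"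
    using open_tube_slice[OF assms(2) compact_path_image[OF assms(1)]] by metis
  then show "\<exists>T. open T \<and> u0 \<in> T \<and> T \<subseteq> reach1 g i \<Omega>"
    by (intro exI[of _ N]) (auto simp: reach1_def)
qed

text \<open>
  A valid path may have an unbounded derivative, so a contour integral along it is first moved
  to a nearby polynomial loop, on which differentiation and exchange of integrals are available.
\<close>
lemma cont_holo_contour_integral:
  assumes F: "cont_holo \<Omega> F" and \<Omega>: "open \<Omega>"
    and g: "valid_path g" and loop: "pathfinish g = pathstart g"
  shows "cont_holo (reach1 g i \<Omega>) (\<lambda>u. contour_integral g (\<lambda>v. F (u(i := v))))"
    (is "cont_holo _ ?I")
proof -
  have cF: "continuous_on \<Omega> F"
    using F by (simp add: cont_holo_def)
  \<comment> \<open>A single polynomial loop \<open>p\<close> replaces \<open>g\<close> for every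
    \<open>u\<close> near \<open>u0\<close>: the integrands are all holomorphic on the same
    \<open>U\<close>, and loops close enough to \<open>g\<close> have equal integrals of such
    functions.\<close>
  have local: "\<exists>N p. open N \<and> u0 \<in> N \<and> polynomial_function p \<and>
      (\<forall>u\<in>N. (\<forall>v\<in>path_image p. u(i := v) \<in> \<Omega>) \<and> ?I u = contour_integral p (\<lambda>v. F (u(i := v))))"
    if u0: "u0 \<in> reach1 g i \<Omega>" for u0
  proof -
    have "\<And>v. v \<in> path_image g \<Longrightarrow> u0(i := v) \<in> \<Omega>"
      using u0 by (simp add: reach1_def)
    then obtain N U where N: "open N" "open U" "u0 \<in> N" "path_image g \<subseteq> U"
        and NU: "\<And>u v. u \<in> N \<Longrightarrow> v \<in> U \<Longrightarrow> u(i := v) \<in> \<Omega>"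
      using open_tube_slice[OF \<Omega> compact_path_image[OF valid_path_imp_path[OF g]]] by metis
    obtain d where d: "0 < d" and dd: "\<And>h h'. valid_path h \<Longrightarrow> valid_path h' \<Longrightarrow>
        (\<forall>s\<in>{0..1}. norm (h s - g s) < d \<and> norm (h' s - g s) < d) \<Longrightarrow>
        pathfinish h = pathstart h \<Longrightarrow> pathfinish h' = pathstart h' \<Longrightarrow>
        path_image h \<subseteq> U \<and> path_image h' \<subseteq> U \<and>
        (\<forall>f. f holomorphic_on U \<longrightarrow> contour_integral h' f = contour_integral h f)"
      using contour_integral_nearby_loops[OF \<open>open U\<close> valid_path_imp_path[OF g] \<open>path_image g \<subseteq> U\<close>] by metis
    obtain p where p: "polynomial_function p" "pathstart p = pathstart g" "pathfinish p = pathfinish g"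
        "\<forall>s\<in>{0..1}. norm (p s - g s) < d"
      using path_approx_polynomial_function[OF valid_path_imp_path[OF g] d] by metis
    have *: "path_image p \<subseteq> U \<and> (\<forall>f. f holomorphic_on U \<longrightarrow> contour_integral p f = contour_integral g f)"
      using dd[OF g valid_path_polynomial_function[OF p(1)]] p d loop by simp
    have "?I u = contour_integral p (\<lambda>v. F (u(i := v)))" if "u \<in> N" for u
    proof -
      have "(\<lambda>v. F (u(i := v))) holomorphic_on U"
        by (rule cont_holo_slice[OF F]) (use NU that in blast)
      then show ?thesis using * by simp
    qed
    moreover have "u(i := v) \<in> \<Omega>" if "u \<in> N" "v \<in> path_image p" for u v
      using * NU that by blast
    ultimately have "\<forall>u\<in>N. (\<forall>v\<in>path_image p. u(i := v) \<in> \<Omega>) \<and> ?I u = contour_integral p (\<lambda>v. F (u(i := v)))"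
      by simp
    then show ?thesis
      using N(1,3) p(1) by (intro exI[of _ N] exI[of _ p]) simp
  qed
  have I_cont: "continuous_on N ?I"
    if "polynomial_function p" and
      N: "\<forall>u\<in>N. (\<forall>v\<in>path_image p. u(i := v) \<in> \<Omega>) \<and> ?I u = contour_integral p (\<lambda>v. F (u(i := v)))"
    for N p
  proof -
    have "continuous_on (N \<times> path_image p) (\<lambda>(u, v). F (u(i := v)))"
      unfolding case_prod_beta
      by (rule continuous_on_compose2[OF cF], intro continuous_on_fun_upd_intros) (use N in auto)
    then have "continuous_on N (\<lambda>u. contour_integral p (\<lambda>v. F (u(i := v))))"
      using continuous_on_contour_integral_param[of N p "\<lambda>u v. F (u(i := v))"]
        valid_path_polynomial_function[OF that(1)] polynomial_path_derivative[OF that(1)]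
      by (simp add: valid_path_imp_path)
    then show ?thesis
      using N by (simp cong: continuous_on_cong)
  qed
  show ?thesis
    unfolding cont_holo_def
  proof (intro conjI ballI allI)
    show "continuous_on (reach1 g i \<Omega>) ?I"
    proof (rule continuous_at_imp_continuous_on, intro ballI)
      fix u0 assume "u0 \<in> reach1 g i \<Omega>"
      from local[OF this] obtain N p where N: "open N" "u0 \<in> N" and "continuous_on N ?I"
        using I_cont by metis
      then show "isCont ?I u0"
        by (simp add: continuous_on_eq_continuous_at)
    qed
  next
    fix u0 j assume "u0 \<in> reach1 g i \<Omega>"
    from local[OF this] obtain N p where N: "open N" "u0 \<in> N" and p: "polynomial_function p" and
        Np: "\<forall>u\<in>N. (\<forall>v\<in>path_image p. u(i := v) \<in> \<Omega>) \<and> ?I u = contour_integral p (\<lambda>v. F (u(i := v)))"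
      by (elim exE conjE)
    show "(\<lambda>w. ?I (u0(j := w))) field_differentiable at (u0 j)"
    proof (cases "j = i")
      case True
      then show ?thesis by simp
    next
      case False
      define T where "T = {w. u0(j := w) \<in> N}"
      have T: "open T" "u0 j \<in> T"
        using N open_slice[OF N(1)] by (auto simp: T_def)
      have p': "continuous_on {0..1} (\<lambda>x. vector_derivative p (at x))"
        by (rule polynomial_path_derivative[OF p])
      have vp: "valid_path p" by (rule valid_path_polynomial_function[OF p])
      have com: "u0(j := w, i := v) = u0(i := v, j := w)" for v w
        using False by (rule fun_upd_twist)
      have in\<Omega>: "u0(j := w, i := v) \<in> \<Omega>" if "w \<in> T" "v \<in> path_image p" for v w
        using that Np unfolding T_def by simp
      have cI: "continuous_on T (\<lambda>w. ?I (u0(j := w)))"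
        by (rule continuous_on_compose2[OF I_cont[OF p Np]], intro continuous_on_fun_upd_intros)
           (auto simp: T_def)
      \<comment> \<open>Morera's criterion: the integral around a triangle is exchanged with the one
        along \<open>p\<close>, and Cauchy's theorem for triangles then makes the inner integral
        vanish for each fixed \<open>v\<close>.\<close>
      have "(\<lambda>w. ?I (u0(j := w))) analytic_on T"
      proof (rule Morera_triangle[OF cI T(1)], intro impI)
        fix a b c assume abc: "convex hull {a, b, c} \<subseteq> T"
        define f where "f = (\<lambda>w v. F (u0(j := w, i := v)))"
        have If: "?I (u0(j := w)) = contour_integral p (f w)" if "w \<in> T" for w
          using Np that by (simp add: f_def T_def)
        have cf: "continuous_on (T \<times> path_image p) (\<lambda>(w, v). f w v)"
          unfolding f_def case_prod_beta
          by (rule continuous_on_compose2[OF cF], intro continuous_on_fun_upd_intros) (use in\<Omega> in auto)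
        have sw: "contour_integral (linepath x y) (\<lambda>w. ?I (u0(j := w))) =
            contour_integral p (\<lambda>v. contour_integral (linepath x y) (\<lambda>w. f w v))"
          and ci: "(\<lambda>v. contour_integral (linepath x y) (\<lambda>w. f w v)) contour_integrable_on p"
          if xy: "x \<in> {a, b, c}" "y \<in> {a, b, c}" for x y
        proof -
          have "closed_segment x y \<subseteq> convex hull {a, b, c}"
            using xy by (intro closed_segment_subset) (auto simp: hull_inc)
          then have seg: "closed_segment x y \<subseteq> T"
            using abc by blast
          have c1: "continuous_on (path_image (linepath x y) \<times> path_image p) (\<lambda>(w, v). f w v)"
            by (rule continuous_on_subset[OF cf]) (use seg in auto)
          have "contour_integral (linepath x y) (\<lambda>w. ?I (u0(j := w))) =
              contour_integral (linepath x y) (\<lambda>w. contour_integral p (f w))"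
            by (rule contour_integral_cong) (use seg If in auto)
          also have "\<dots> = contour_integral p (\<lambda>v. contour_integral (linepath x y) (\<lambda>w. f w v))"
            by (rule contour_integral_swap[OF c1 _ vp _ p']) auto
          finally show "contour_integral (linepath x y) (\<lambda>w. ?I (u0(j := w))) =
            contour_integral p (\<lambda>v. contour_integral (linepath x y) (\<lambda>w. f w v))" .
          have "continuous_on (path_image p \<times> path_image (linepath x y)) (\<lambda>(v, w). f w v)"
            unfolding f_def case_prod_beta
            by (rule continuous_on_compose2[OF cF], intro continuous_on_fun_upd_intros) (use in\<Omega> seg in auto)
          then have "continuous_on (path_image p) (\<lambda>v. contour_integral (linepath x y) (\<lambda>w. f w v))"
            by (rule continuous_on_contour_integral_param) auto
          then show "(\<lambda>v. contour_integral (linepath x y) (\<lambda>w. f w v)) contour_integrable_on p"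
            by (rule contour_integrable_continuous_C1[OF _ valid_path_imp_path[OF vp] p'])
        qed
        have tri: "contour_integral (linepath a b) (\<lambda>w. f w v) + contour_integral (linepath b c) (\<lambda>w. f w v)
            + contour_integral (linepath c a) (\<lambda>w. f w v) = 0" if v: "v \<in> path_image p" for v
        proof -
          have "(\<lambda>w. f w v) holomorphic_on T"
            unfolding f_def com by (rule cont_holo_slice[OF F]) (use in\<Omega>[OF _ v] com in auto)
          then have h: "(\<lambda>w. f w v) holomorphic_on convex hull {a, b, c}"
            using abc holomorphic_on_subset by blast
          then show ?thesis
            by (intro has_chain_integral_chain_integral3 Cauchy_theorem_triangle)
        qed
        have "contour_integral (linepath a b) (\<lambda>w. ?I (u0(j := w))) +
              contour_integral (linepath b c) (\<lambda>w. ?I (u0(j := w))) +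
              contour_integral (linepath c a) (\<lambda>w. ?I (u0(j := w))) =
            contour_integral p (\<lambda>v. contour_integral (linepath a b) (\<lambda>w. f w v)
              + contour_integral (linepath b c) (\<lambda>w. f w v) + contour_integral (linepath c a) (\<lambda>w. f w v))"
          by (simp add: sw ci contour_integral_add contour_integrable_add)
        also have "\<dots> = contour_integral p (\<lambda>v. 0)"
          by (rule contour_integral_cong) (use tri in auto)
        finally show "contour_integral (linepath a b) (\<lambda>w. ?I (u0(j := w))) +
              contour_integral (linepath b c) (\<lambda>w. ?I (u0(j := w))) +
              contour_integral (linepath c a) (\<lambda>w. ?I (u0(j := w))) = 0"
          by simp
      qed
      then show ?thesis
        using T analytic_on_imp_differentiable_at by blast
    qed
  qed
qed

section \<open>Iterated contour integrals\<close>

text \<open>The variables form a list, outermost first, because those that survive the removal of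
  the variables of sign 1 need not be an initial segment of the indices.\<close>

primrec iterated_integral ::
  "(nat \<Rightarrow> real \<Rightarrow> complex) \<Rightarrow> nat list \<Rightarrow> ((nat \<Rightarrow> complex) \<Rightarrow> complex) \<Rightarrow> (nat \<Rightarrow> complex) \<Rightarrow> complex"
where
  "iterated_integral \<gamma> [] F u = F u"
| "iterated_integral \<gamma> (i # xs) F u =
     contour_integral (\<gamma> i) (\<lambda>w. iterated_integral \<gamma> xs F (u(i := w)))"

lemma multi_contour_integral_eq_iterated:
  "multi_contour_integral \<gamma> m F u = iterated_integral \<gamma> (rev [1..<Suc m]) F u"
  by (induction m arbitrary: u) simp_all

lemma iterated_integral_cong:
  assumes "\<And>v. (\<And>i. i \<in> set xs \<Longrightarrow> v i \<in> path_image (\<gamma> i)) \<Longrightarrow> (\<And>i. i \<notin> set xs \<Longrightarrow> v i = u i) \<Longrightarrow> F v = F' v"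
  shows "iterated_integral \<gamma> xs F u = iterated_integral \<gamma> xs F' u"
  using assms
proof (induction xs arbitrary: u)
  case (Cons i xs)
  show ?case
    unfolding iterated_integral.simps
  proof (rule contour_integral_cong[OF refl])
    fix w assume w: "w \<in> path_image (\<gamma> i)"
    show "iterated_integral \<gamma> xs F (u(i := w)) = iterated_integral \<gamma> xs F' (u(i := w))"
    proof (rule Cons.IH)
      fix v assume v: "\<And>j. j \<in> set xs \<Longrightarrow> v j \<in> path_image (\<gamma> j)" "\<And>j. j \<notin> set xs \<Longrightarrow> v j = (u(i := w)) j"
      have "v i \<in> path_image (\<gamma> i)"
        using v w by (cases "i \<in> set xs") auto
      then show "F v = F' v"
        using v by (intro Cons.prems) auto
    qed
  qed
qed simp

lemma iterated_integral_indep: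
  assumes "\<And>v v'. (\<And>i. i \<in> set xs \<or> i \<in> X \<Longrightarrow> v i = v' i) \<Longrightarrow> F v = F v'"
    and "\<And>i. i \<in> X \<Longrightarrow> u i = u' i"
  shows "iterated_integral \<gamma> xs F u = iterated_integral \<gamma> xs F u'"
  using assms
proof (induction xs arbitrary: u u' X)
  case (Cons i xs)
  show ?case
    unfolding iterated_integral.simps
  proof (rule contour_integral_cong[OF refl])
    fix w
    \<comment> \<open>Once fixed at \<open>w\<close>, coordinate \<open>i\<close> is one where both
      starting tuples agree, so it passes from the list to \<open>X\<close>.\<close>
    show "iterated_integral \<gamma> xs F (u(i := w)) = iterated_integral \<gamma> xs F (u'(i := w))"
    proof (rule Cons.IH[of "insert i X"])
      show "F v = F v'" if "\<And>j. j \<in> set xs \<or> j \<in> insert i X \<Longrightarrow> v j = v' j" for v v'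
        by (rule Cons.prems(1)) (rule that, auto)
      show "(u(i := w)) j = (u'(i := w)) j" if "j \<in> insert i X" for j
        using that Cons.prems(2) by auto
    qed
  qed
next
  case Nil
  show ?case
    unfolding iterated_integral.simps by (rule Nil.prems(1)) (simp add: Nil.prems(2))
qed

text \<open>For \<open>c \<noteq> 0\<close>, \<open>c * f\<close> is integrable exactly when
  \<open>f\<close> is, and otherwise both integrals have the default value 0. Constants can thus be
  moved out without any analysis, in contrast to sums.\<close>

lemma contour_integral_cmult: "contour_integral g (\<lambda>w. c * f w) = c * contour_integral g f"
proof (cases "c = 0 \<or> f contour_integrable_on g")
  case True
  then show ?thesis by (auto simp: contour_integral_lmul)
next
  case False
  then show ?thesis
    by (simp add: contour_integrable_lmul_iff not_integrable_contour_integral)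
qed

lemma iterated_integral_cmult:
  "iterated_integral \<gamma> xs (\<lambda>u. c * F u) u = c * iterated_integral \<gamma> xs F u"
  by (induction xs arbitrary: u) (simp_all add: contour_integral_cmult)

fun reach ::
  "(nat \<Rightarrow> real \<Rightarrow> complex) \<Rightarrow> nat list \<Rightarrow> (nat \<Rightarrow> complex) set \<Rightarrow> (nat \<Rightarrow> complex) set"
where
  "reach \<gamma> [] \<Omega> = \<Omega>"
| "reach \<gamma> (i # xs) \<Omega> = reach1 (\<gamma> i) i (reach \<gamma> xs \<Omega>)"

lemma in_reachI:
  assumes "\<And>v. (\<And>i. i \<in> set xs \<Longrightarrow> v i \<in> path_image (\<gamma> i)) \<Longrightarrow> (\<And>i. i \<notin> set xs \<Longrightarrow> v i = u i) \<Longrightarrow> v \<in> \<Omega>"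
  shows "u \<in> reach \<gamma> xs \<Omega>"
  using assms
proof (induction xs arbitrary: u)
  case Nil
  then show ?case by simp
next
  case (Cons i xs)
  have "u(i := w) \<in> reach \<gamma> xs \<Omega>" if w: "w \<in> path_image (\<gamma> i)" for w
  proof (rule Cons.IH)
    fix v assume v: "\<And>j. j \<in> set xs \<Longrightarrow> v j \<in> path_image (\<gamma> j)" "\<And>j. j \<notin> set xs \<Longrightarrow> v j = (u(i := w)) j"
    have "v i \<in> path_image (\<gamma> i)"
      using v w by (cases "i \<in> set xs") auto
    then show "v \<in> \<Omega>"
      using v by (intro Cons.prems) auto
  qed
  then show ?case by (simp add: reach1_def)
qed

lemma open_reach:
  assumes "\<And>i. i \<in> set xs \<Longrightarrow> path (\<gamma> i)" "open \<Omega>"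
  shows "open (reach \<gamma> xs \<Omega>)"
  using assms(1) by (induction xs) (simp_all add: assms(2) open_reach1)

text \<open>The class \<open>cont_holo\<close> is stable under integrating out one coordinate, on a
  domain that stays open; this is what makes the induction on the list run.\<close>

lemma cont_holo_iterated_integral:
  assumes "cont_holo \<Omega> F" "open \<Omega>"
    and "\<And>i. i \<in> set xs \<Longrightarrow> valid_path (\<gamma> i) \<and> pathfinish (\<gamma> i) = pathstart (\<gamma> i)"
  shows "cont_holo (reach \<gamma> xs \<Omega>) (iterated_integral \<gamma> xs F)"
  using assms(3)
proof (induction xs)
  case Nil
  have "iterated_integral \<gamma> [] F = F" by (rule ext) simp
  then show ?case using assms(1) by simp
next
  case (Cons i xs)
  have "iterated_integral \<gamma> (i # xs) F = (\<lambda>u. contour_integral (\<gamma> i) (\<lambda>w. iterated_integral \<gamma> xs F (u(i := w))))"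
    by (rule ext) simp
  moreover have "open (reach \<gamma> xs \<Omega>)"
    by (rule open_reach) (use Cons.prems assms(2) valid_path_imp_path in auto)
  ultimately show ?case
    using cont_holo_contour_integral[of "reach \<gamma> xs \<Omega>" "iterated_integral \<gamma> xs F" "\<gamma> i" i] Cons
    by simp
qed

text \<open>Each inner integral is holomorphic in the next variable on an open set containing its
  contour, hence integrable along it, so additivity can be applied level by level.\<close>

lemma iterated_integral_sum:
  assumes "finite S" and F: "\<And>s. s \<in> S \<Longrightarrow> cont_holo \<Omega> (F s)" and \<Omega>: "open \<Omega>"
    and \<gamma>: "\<And>i. i \<in> set xs \<Longrightarrow> valid_path (\<gamma> i) \<and> pathfinish (\<gamma> i) = pathstart (\<gamma> i)"
    and u: "u \<in> reach \<gamma> xs \<Omega>"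
  shows "iterated_integral \<gamma> xs (\<lambda>u. \<Sum>s\<in>S. F s u) u = (\<Sum>s\<in>S. iterated_integral \<gamma> xs (F s) u)"
  using \<gamma> u
proof (induction xs arbitrary: u)
  case (Cons i xs)
  let ?R = "reach \<gamma> xs \<Omega>"
  have R: "open ?R"
    by (rule open_reach) (use Cons.prems(1) \<Omega> valid_path_imp_path in auto)
  have up: "u(i := w) \<in> ?R" if "w \<in> path_image (\<gamma> i)" for w
    using Cons.prems(2) that by (simp add: reach1_def)
  have int: "(\<lambda>w. iterated_integral \<gamma> xs (F s) (u(i := w))) contour_integrable_on \<gamma> i" if "s \<in> S" for s
  proof (rule contour_integrable_holomorphic_simple[OF _ open_slice[OF R, of u i]])
    have "cont_holo ?R (iterated_integral \<gamma> xs (F s))"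
      using Cons.prems(1) F[OF that] \<Omega> by (intro cont_holo_iterated_integral) auto
    then show "(\<lambda>w. iterated_integral \<gamma> xs (F s) (u(i := w))) holomorphic_on {w. u(i := w) \<in> ?R}"
      by (rule cont_holo_slice) simp
  qed (use Cons.prems up in auto)
  have "iterated_integral \<gamma> (i # xs) (\<lambda>u. \<Sum>s\<in>S. F s u) u =
      contour_integral (\<gamma> i) (\<lambda>w. \<Sum>s\<in>S. iterated_integral \<gamma> xs (F s) (u(i := w)))"
    unfolding iterated_integral.simps
    by (rule contour_integral_cong[OF refl]) (use Cons.IH Cons.prems(1) up in auto)
  also have "\<dots> = (\<Sum>s\<in>S. contour_integral (\<gamma> i) (\<lambda>w. iterated_integral \<gamma> xs (F s) (u(i := w))))"
    using assms(1) int by (rule contour_integral_sum)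
  finally show ?case by simp
qed simp

section \<open>Rational functions with all poles inside the contour\<close>

text \<open>By the Jordan curve theorem the inside is connected, so the winding number there is
  constant and equals its value at the origin.\<close>

lemma ccw_winding_number_inside:
  assumes "ccw_around_origin g" "b \<in> inside (path_image g)"
  shows "winding_number g b = 1"
proof -
  have g: "simple_path g" "pathfinish g = pathstart g" "0 \<in> inside (path_image g)" "winding_number g 0 = 1"
    using assms(1) by (auto simp: ccw_around_origin_def)
  then have "connected (inside (path_image g))"
    using Jordan_inside_outside by blast
  then have "winding_number g b = winding_number g 0"
    using winding_number_eq[of g b "inside (path_image g)" 0] g assms(2) inside_no_overlap
    by (simp add: simple_path_imp_path)
  then show ?thesis using g by simp
qed

text \<open>With at least two poles, counted with multiplicity, the integrand decays like
  \<open>v\<close> to the power -2 or faster and has no residue at infinity. Points may coincide;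
  the separate power of \<open>v - b\<close> absorbs the entries of the list that are equal to
  \<open>b\<close>.\<close>

lemma contour_integral_reciprocal_product:
  assumes g: "ccw_around_origin g" and b: "b \<in> inside (path_image g)"
    and "\<And>c. c \<in> set cs \<Longrightarrow> c \<in> inside (path_image g)" and "n + length cs \<ge> 1"
  shows "((\<lambda>v. 1 / ((v - b) ^ n * (\<Prod>c\<leftarrow>cs. v - c))) has_contour_integral
           (if n + length cs = 1 then 2 * of_real pi * \<i> else 0)) g"
  using assms(2-)
proof (induction cs arbitrary: b n)
  case Nil
  have vg: "valid_path g" and loop: "pathfinish g = pathstart g"
    using g by (auto simp: ccw_around_origin_def)
  have nb: "b \<notin> path_image g"
    using Nil(1) inside_no_overlap by blast
  show ?case
  proof (cases "n = 1")
    case True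
    then show ?thesis
      using has_contour_integral_winding_number[OF vg nb] ccw_winding_number_inside[OF g Nil(1)] by simp
  next
    case False
    then obtain m where m: "n = Suc (Suc m)"
      using Nil(3) by (cases n; cases "n - 1") auto
    have "((\<lambda>v. 1 / (v - b) ^ n) has_contour_integral
        (-1 / (of_nat (Suc m) * (pathfinish g - b) ^ Suc m)) - (-1 / (of_nat (Suc m) * (pathstart g - b) ^ Suc m))) g"
    proof (rule contour_integral_primitive[where S = "- {b}"])
      fix v assume "v \<in> - {b}"
      then have v: "v - b \<noteq> 0" by simp
      have nz: "(1 + of_nat m :: complex) \<noteq> 0"
        using of_nat_neq_0[of m, where ?'a = complex] by simp
      show "((\<lambda>v. -1 / (of_nat (Suc m) * (v - b) ^ Suc m)) has_field_derivative 1 / (v - b) ^ n) (at v within - {b})"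
        unfolding m
        by (rule derivative_eq_intros refl | use v nz in \<open>simp; fail\<close>)+
    qed (use vg nb in auto)
    then show ?thesis using loop m by simp
  qed
next
  case (Cons c cs)
  note IH = Cons.IH
  have c: "c \<in> inside (path_image g)" and cs: "\<And>d. d \<in> set cs \<Longrightarrow> d \<in> inside (path_image g)"
    using Cons.prems by auto
  show ?case
    using Cons.prems(1,3)
  proof (induction n)
    case 0
    then show ?case using IH[OF c cs, of 1] by simp
  next
    case (Suc n)
    show ?case
    proof (cases "c = b")
      case True
      then show ?thesis using IH[OF c cs, of "Suc (Suc n)"] by (simp add: mult_ac)
    next
      case False
      have 1: "((\<lambda>v. 1 / ((v - b) ^ n * (\<Prod>c\<leftarrow>c # cs. v - c))) has_contour_integral
          (if n + length (c # cs) = 1 then 2 * of_real pi * \<i> else 0)) g"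
        using Suc by simp
      have 2: "((\<lambda>v. 1 / ((v - b) ^ Suc n * (\<Prod>c\<leftarrow>cs. v - c))) has_contour_integral
          (if Suc n + length cs = 1 then 2 * of_real pi * \<i> else 0)) g"
        using IH[OF Suc.prems(1) cs, of "Suc n"] by simp
      \<comment> \<open>Partial fractions in the two distinct points \<open>b\<close> and
        \<open>c\<close>. Both terms have the same number of poles, hence the same integral, and
        their difference integrates to 0.\<close>
      have "((\<lambda>v. 1 / (c - b) * (1 / ((v - b) ^ n * (\<Prod>c\<leftarrow>c # cs. v - c)) - 1 / ((v - b) ^ Suc n * (\<Prod>c\<leftarrow>cs. v - c))))
          has_contour_integral 0) g"
        using has_contour_integral_lmul[OF has_contour_integral_diff[OF 1 2], of "1 / (c - b)"] by simp
      then have "((\<lambda>v. 1 / ((v - b) ^ Suc n * (\<Prod>c\<leftarrow>c # cs. v - c))) has_contour_integral 0) g"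
      proof (rule has_contour_integral_eq)
        fix v assume "v \<in> path_image g"
        then have v: "v \<noteq> b" "v \<noteq> c" and "\<And>d. d \<in> set cs \<Longrightarrow> v \<noteq> d"
          using Suc.prems(1) c cs inside_no_overlap by blast+
        then have "(\<Prod>c\<leftarrow>cs. v - c) \<noteq> 0"
          by (auto simp: prod_list_zero_iff)
        with v False show "1 / (c - b) * (1 / ((v - b) ^ n * (\<Prod>c\<leftarrow>c # cs. v - c)) - 1 / ((v - b) ^ Suc n * (\<Prod>c\<leftarrow>cs. v - c)))
            = 1 / ((v - b) ^ Suc n * (\<Prod>c\<leftarrow>c # cs. v - c))"
          by (simp add: divide_simps)
      qed
      then show ?thesis using Suc by simp
    qed
  qed
qed

text \<open>These functions behave like 1 / (2 pi i v) at infinity and have all their poles inside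
  \<open>g\<close>; the zeros \<open>c\<close> are arbitrary. The inductive form makes
  multiplication by one more kernel factor a constructor.\<close>

inductive unital_on :: "(real \<Rightarrow> complex) \<Rightarrow> (complex \<Rightarrow> complex) \<Rightarrow> bool" for g where
  pole: "b \<in> inside (path_image g) \<Longrightarrow> unital_on g (\<lambda>v. 1 / (2 * of_real pi * \<i> * (v - b)))"
| ratio: "unital_on g f \<Longrightarrow> b \<in> inside (path_image g) \<Longrightarrow> unital_on g (\<lambda>v. f v * ((v - c) / (v - b)))"

lemma unital_on_prod:
  assumes "unital_on g f" "\<And>s. s \<in> S \<Longrightarrow> b s \<in> inside (path_image g)"
  shows "unital_on g (\<lambda>v. f v * (\<Prod>s\<in>S. (v - c s) / (v - b s)))"
  using assms
proof (induction S rule: infinite_finite_induct)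
  case (insert s S)
  have "unital_on g (\<lambda>v. (f v * (\<Prod>s\<in>S. (v - c s) / (v - b s))) * ((v - c s) / (v - b s)))"
    by (rule unital_on.ratio) (use insert in auto)
  then show ?case
    using insert by (simp add: mult_ac)
qed simp_all

text \<open>The extra denominators \<open>bs\<close> strengthen the induction: (v - c) / (v - b) is
  1 + (b - c) / (v - b), and the second term only adds \<open>b\<close> to the list, where the
  integral is already known to be 0.\<close>

lemma unital_on_integral:
  assumes g: "ccw_around_origin g" and "unital_on g f"
    and "\<And>b. b \<in> set bs \<Longrightarrow> b \<in> inside (path_image g)"
  shows "((\<lambda>v. f v / (\<Prod>b\<leftarrow>bs. v - b)) has_contour_integral (if bs = [] then 1 else 0)) g"
  using assms(2-)
proof (induction arbitrary: bs rule: unital_on.induct)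
  case (pole b)
  have "((\<lambda>v. 1 / ((v - b) ^ 1 * (\<Prod>c\<leftarrow>bs. v - c))) has_contour_integral
           (if 1 + length bs = 1 then 2 * of_real pi * \<i> else 0)) g"
    using contour_integral_reciprocal_product[OF g pole(1) pole(2), of bs 1] by simp
  from has_contour_integral_lmul[OF this, of "1 / (2 * of_real pi * \<i>)"]
  have "((\<lambda>v. 1 / (2 * of_real pi * \<i>) * (1 / ((v - b) ^ 1 * (\<Prod>c\<leftarrow>bs. v - c)))) has_contour_integral
      (if bs = [] then 1 else 0)) g"
    by (cases bs) simp_all
  then show ?case
    by (rule has_contour_integral_eq) simp
next
  case (ratio f b c)
  have "((\<lambda>v. f v / (\<Prod>b\<leftarrow>bs. v - b) + (b - c) * (f v / (\<Prod>b\<leftarrow>b # bs. v - b))) has_contour_integral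
        (if bs = [] then 1 else 0) + (b - c) * (if b # bs = [] then 1 else 0)) g"
    using ratio.prems ratio.hyps(2)
    by (intro has_contour_integral_add has_contour_integral_lmul ratio.IH) auto
  then have "((\<lambda>v. f v / (\<Prod>b\<leftarrow>bs. v - b) + (b - c) * (f v / (\<Prod>b\<leftarrow>b # bs. v - b))) has_contour_integral
        (if bs = [] then 1 else 0)) g"
    by simp
  then show ?case
  proof (rule has_contour_integral_eq)
    fix v assume "v \<in> path_image g"
    then have v: "v - b \<noteq> 0"
      using ratio.hyps(2) \<open>v \<in> path_image g\<close> inside_no_overlap[of "path_image g"]
      by (metis IntI empty_iff eq_iff_diff_eq_0)
    have "v \<noteq> d" if "d \<in> set bs" for d
      using ratio.prems[OF that] \<open>v \<in> path_image g\<close> inside_no_overlap[of "path_image g"] by blast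
    then have "(\<Prod>c\<leftarrow>bs. v - c) \<noteq> 0"
      by (auto simp: prod_list_zero_iff)
    with v show "f v / (\<Prod>b\<leftarrow>bs. v - b) + (b - c) * (f v / (\<Prod>b\<leftarrow>b # bs. v - b))
        = f v * ((v - c) / (v - b)) / (\<Prod>b\<leftarrow>bs. v - b)"
      by (simp add: field_simps)
  qed
qed

section \<open>Products over pairs of variables, and the removal of unital variables\<close>

definition pair_product ::
  "(nat \<Rightarrow> nat \<Rightarrow> complex \<Rightarrow> complex \<Rightarrow> complex) \<Rightarrow> (nat \<Rightarrow> complex \<Rightarrow> complex) \<Rightarrow> nat set \<Rightarrow> (nat \<Rightarrow> complex) \<Rightarrow> complex"
where
  "pair_product K f X u = (\<Prod>i\<in>X. f i (u i)) * (\<Prod>i\<in>X. \<Prod>j\<in>X \<inter> {i<..}. K i j (u i) (u j))"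

text \<open>A new largest index comes second in each of its pairs. With its variable frozen, the
  kernels merely modify the one-variable factors of the others, so the shape of the product is
  kept.\<close>

lemma pair_product_insert:
  assumes "finite X" "\<And>i. i \<in> X \<Longrightarrow> i < m"
  shows "pair_product K f (insert m X) u = f m (u m) * pair_product K (\<lambda>i v. f i v * K i m v (u m)) X u"
proof -
  have m: "m \<notin> X" using assms by blast
  have 1: "insert m X \<inter> {m<..} = {}" using assms by force
  have "(\<Prod>j\<in>insert m X \<inter> {i<..}. K i j (u i) (u j)) = K i m (u i) (u m) * (\<Prod>j\<in>X \<inter> {i<..}. K i j (u i) (u j))"
    if "i \<in> X" for i
  proof -
    have "insert m X \<inter> {i<..} = insert m (X \<inter> {i<..})"
      using that assms by auto
    then show ?thesis using assms m by simp
  qed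
  then show ?thesis
    using assms m 1 by (simp add: pair_product_def prod.distrib mult_ac)
qed

lemma pair_product_cong:
  assumes "\<And>i. i \<in> X \<Longrightarrow> f i (u i) = f' i (v i)"
    and "\<And>i j. i \<in> X \<Longrightarrow> j \<in> X \<Longrightarrow> i < j \<Longrightarrow> K i j (u i) (u j) = K' i j (v i) (v j)"
  shows "pair_product K f X u = pair_product K' f' X v"
  unfolding pair_product_def using assms by (intro arg_cong2[where f = "(*)"] prod.cong) auto

text \<open>
  The outermost variable is split off first, so that its factors are absorbed into the
  one-variable factors of the remaining ones.
\<close>
lemma iterated_integral_remove_unital:
  assumes "sorted_wrt (>) xs"
    and "\<And>i. i \<in> set xs \<Longrightarrow> ccw_around_origin (\<gamma> i)"
    and "\<And>i. i \<in> set xs \<Longrightarrow> \<not> P i \<Longrightarrow> unital_on (\<gamma> i) (f i)"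
    and "\<And>i j w h. i \<in> set xs \<Longrightarrow> j \<in> set xs \<Longrightarrow> i < j \<Longrightarrow> \<not> P i \<Longrightarrow> w \<in> path_image (\<gamma> j) \<Longrightarrow>
           unital_on (\<gamma> i) h \<Longrightarrow> unital_on (\<gamma> i) (\<lambda>v. h v * K i j v w)"
    and "\<And>i j v w. i \<in> set xs \<Longrightarrow> j \<in> set xs \<Longrightarrow> i < j \<Longrightarrow> P i \<Longrightarrow> \<not> P j \<Longrightarrow>
           v \<in> path_image (\<gamma> i) \<Longrightarrow> w \<in> path_image (\<gamma> j) \<Longrightarrow> K i j v w = 1"
  shows "iterated_integral \<gamma> xs (pair_product K f (set xs)) u =
         iterated_integral \<gamma> (filter P xs) (pair_product K f (set (filter P xs))) u"
  using assms
proof (induction xs arbitrary: f u)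
  case (Cons j ys)
  have less: "\<And>i. i \<in> set ys \<Longrightarrow> i < j"
    using Cons.prems(1) by simp
  define f' where "f' = (\<lambda>w i v. f i v * K i j v w)"
  let ?I = "\<lambda>xs f. iterated_integral \<gamma> xs (pair_product K f (set xs))"
  have split: "iterated_integral \<gamma> zs (pair_product K f (set (j # zs))) (u(j := w)) = f j w * ?I zs (f' w) (u(j := w))"
    if "set zs \<subseteq> set ys" for zs w
  proof -
    have "iterated_integral \<gamma> zs (pair_product K f (set (j # zs))) (u(j := w))
        = iterated_integral \<gamma> zs (\<lambda>v. f j w * pair_product K (f' w) (set zs) v) (u(j := w))"
    proof (rule iterated_integral_cong)
      fix v assume "\<And>i. i \<notin> set zs \<Longrightarrow> v i = (u(j := w)) i"
      moreover have "j \<notin> set zs" using less that by blast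
      ultimately have "v j = w" by simp
      then show "pair_product K f (set (j # zs)) v = f j w * pair_product K (f' w) (set zs) v"
        using pair_product_insert[of "set zs" j K f v] less that by (auto simp: f'_def)
    qed
    then show ?thesis by (simp add: iterated_integral_cmult)
  qed
  have IH: "?I ys (f' w) (u(j := w)) = ?I (filter P ys) (f' w) (u(j := w))"
    if w: "w \<in> path_image (\<gamma> j)" for w
  proof (rule Cons.IH)
    show "unital_on (\<gamma> i) (f' w i)" if "i \<in> set ys" "\<not> P i" for i
      unfolding f'_def by (rule Cons.prems(4)) (use that w less Cons.prems(3)[of i] in auto)
    show "unital_on (\<gamma> i) (\<lambda>v. h v * K i k v w')"
      if "i \<in> set ys" "k \<in> set ys" "i < k" "\<not> P i" "w' \<in> path_image (\<gamma> k)" "unital_on (\<gamma> i) h" for i k w' h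
      using Cons.prems(4)[of i k w' h] that by simp
    show "K i k v w' = 1"
      if "i \<in> set ys" "k \<in> set ys" "i < k" "P i" "\<not> P k" "v \<in> path_image (\<gamma> i)" "w' \<in> path_image (\<gamma> k)" for i k v w'
      using Cons.prems(5)[of i k v w'] that by simp
  qed (use Cons.prems(1,2) in auto)
  show ?case
  proof (cases "P j")
    case True
    have "?I (j # ys) f u = contour_integral (\<gamma> j) (\<lambda>w. f j w * ?I (filter P ys) (f' w) (u(j := w)))"
      unfolding iterated_integral.simps split[OF order_refl]
      by (rule contour_integral_cong[OF refl]) (simp only: IH)
    also have "\<dots> = ?I (j # filter P ys) f u"
      unfolding iterated_integral.simps
      by (rule contour_integral_cong[OF refl], rule split[symmetric]) auto
    finally show ?thesis using True by simp
  next
    case False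
    \<comment> \<open>The surviving variables have smaller indices and satisfy \<open>P\<close>, so
      their kernels with \<open>j\<close> are 1 on the contours. The inner integral no longer sees
      \<open>w\<close> and leaves the integral of \<open>f j\<close>, which is 1.\<close>
    have forget: "?I (filter P ys) (f' w) (u(j := w)) = ?I (filter P ys) f u" if w: "w \<in> path_image (\<gamma> j)" for w
    proof -
      have "?I (filter P ys) (f' w) (u(j := w)) = ?I (filter P ys) f (u(j := w))"
      proof (rule iterated_integral_cong, rule pair_product_cong)
        fix v i
        assume v: "\<And>i. i \<in> set (filter P ys) \<Longrightarrow> v i \<in> path_image (\<gamma> i)" and i: "i \<in> set (filter P ys)"
        then have "K i j (v i) w = 1"
          using Cons.prems(5)[of i j "v i" w] False w less[of i] v[OF i] by simp
        then show "f' w i (v i) = f i (v i)" by (simp add: f'_def)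
      qed simp
      also have "\<dots> = ?I (filter P ys) f u"
        by (rule iterated_integral_indep[where X = "{}"], rule pair_product_cong) auto
      finally show ?thesis .
    qed
    have "((\<lambda>v. f j v / (\<Prod>b\<leftarrow>[]. v - b)) has_contour_integral (if [] = ([]::complex list) then 1 else 0)) (\<gamma> j)"
      by (rule unital_on_integral) (use Cons.prems(2)[of j] Cons.prems(3)[of j] False in auto)
    then have int: "(f j has_contour_integral 1) (\<gamma> j)" by simp
    have *: "?I ys (f' w) (u(j := w)) = ?I (filter P ys) f u" if "w \<in> path_image (\<gamma> j)" for w
      using IH[OF that] forget[OF that] by (rule trans)
    have "?I (j # ys) f u = contour_integral (\<gamma> j) (\<lambda>w. ?I (filter P ys) f u * f j w)"
      unfolding iterated_integral.simps split[OF order_refl]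
      by (rule contour_integral_cong[OF refl]) (simp only: * mult.commute)
    also have "\<dots> = ?I (filter P ys) f u"
      unfolding contour_integral_cmult contour_integral_unique[OF int] by simp
    finally show ?thesis using False by simp
  qed
qed simp

section \<open>A signed sum of Vandermonde determinants\<close>

text \<open>As a function of the last node, the determinant is a polynomial of degree at most
  \<open>n\<close> that vanishes at the other nodes and has the smaller Vandermonde product as its
  coefficient of degree \<open>n\<close>. If the other nodes are not distinct, both sides are
  0.\<close>

lemma vandermonde_det:
  fixes x :: "nat \<Rightarrow> complex"
  shows "Determinant.det (Matrix.mat n n (\<lambda>(i, j). x (Suc i) ^ j)) = (\<Prod>a\<in>{1..n}. \<Prod>b\<in>{a<..n}. x b - x a)"
proof (induction n arbitrary: x)
  case 0
  show ?case by (simp add: det_def)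
next
  case (Suc n)
  define V where "V n x = (\<Prod>a\<in>{1..n}. \<Prod>b\<in>{a<..n}. x b - x a)" for n and x :: "nat \<Rightarrow> complex"
  define M where "M x = Matrix.mat (Suc n) (Suc n) (\<lambda>(i, j). x (Suc i) ^ j)" for x :: "nat \<Rightarrow> complex"
  have M: "M x \<in> carrier_mat (Suc n) (Suc n)" for x
    by (simp add: M_def)
  have V: "V (Suc n) x = V n x * (\<Prod>a\<in>{1..n}. x (Suc n) - x a)" for x
  proof -
    have "(\<Prod>b\<in>{a<..Suc n}. x b - x a) = (\<Prod>b\<in>{a<..n}. x b - x a) * (x (Suc n) - x a)" if "a \<in> {1..n}" for a
    proof -
      have "{a<..Suc n} = insert (Suc n) {a<..n}" using that by auto
      then show ?thesis by (simp add: mult.commute)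
    qed
    then show ?thesis by (simp add: V_def prod.distrib)
  qed
  have rep: "Determinant.det (M x) = 0" if "a \<in> {1..n}" "x a = x (Suc n)" for a x
    using that by (intro det_identical_rows[OF M, of "a - 1" n]) (auto simp: M_def intro!: eq_vecI)
  show ?case
  proof (cases "inj_on x {1..n}")
    case False
    then obtain a b where ab: "a \<in> {1..n}" "b \<in> {1..n}" "a < b" "x a = x b"
      unfolding inj_on_def by (metis linorder_neqE_nat)
    have "Determinant.det (M x) = 0"
      using ab by (intro det_identical_rows[OF M, of "a - 1" "b - 1"]) (auto simp: M_def intro!: eq_vecI)
    moreover have "V n x = 0"
    proof -
      have "\<exists>a\<in>{1..n}. \<exists>b\<in>{a<..n}. x b - x a = 0"
        using ab by (intro bexI[of _ a] bexI[of _ b]) auto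
      then show ?thesis by (auto simp: V_def)
    qed
    ultimately show ?thesis using V by (simp add: M_def V_def)
  next
    case True
    \<comment> \<open>The last node is made variable. The cofactors along the last row do not
      contain it, so they are the coefficients of the polynomial \<open>Q\<close>.\<close>
    define y where "y w = x(Suc n := w)" for w
    define C where "C j = cofactor (M x) n j" for j
    have C: "cofactor (M (y w)) n j = C j" if "j < Suc n" for w j
    proof -
      have "mat_delete (M (y w)) n j = mat_delete (M x) n j"
        unfolding mat_delete_def M_def y_def using that by (intro eq_matI) auto
      then show ?thesis by (simp add: C_def cofactor_def)
    qed
    have Cn: "C n = V n x"
    proof -
      have "mat_delete (M x) n n = Matrix.mat n n (\<lambda>(i, j). x (Suc i) ^ j)"
        unfolding mat_delete_def M_def by (intro eq_matI) auto
      then show ?thesis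
        unfolding C_def cofactor_def using Suc.IH[of x] by (simp add: V_def)
    qed
    define Q where "Q = (\<Sum>j<Suc n. Polynomial.monom (C j) j)"
    have Q: "poly Q w = Determinant.det (M (y w))" for w
    proof -
      have "Determinant.det (M (y w)) = (\<Sum>j<Suc n. M (y w) $$ (n, j) * cofactor (M (y w)) n j)"
        by (rule laplace_expansion_row[OF M]) simp
      also have "\<dots> = (\<Sum>j<Suc n. w ^ j * C j)"
      proof (rule sum.cong[OF refl])
        fix j assume "j \<in> {..<Suc n}"
        then have j: "j < Suc n" by simp
        then have "M (y w) $$ (n, j) = w ^ j" by (simp add: M_def y_def)
        then show "M (y w) $$ (n, j) * cofactor (M (y w)) n j = w ^ j * C j"
          using C[OF j] by simp
      qed
      finally show ?thesis
        by (simp add: Q_def poly_sum poly_monom mult.commute)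
    qed
    define R where "R = Q - Polynomial.smult (V n x) (\<Prod>a\<in>{1..n}. [:- x a, 1:])"
    have "R = 0"
    proof (rule ccontr)
      assume "R \<noteq> 0"
      have lead: "degree (\<Prod>a\<in>{1..n}. [:- x a, 1:]) = n" "coeff (\<Prod>a\<in>{1..n}. [:- x a, 1:]) n = 1"
      proof -
        show d: "degree (\<Prod>a\<in>{1..n}. [:- x a, 1:]) = n"
          by (subst degree_prod_eq_sum_degree) auto
        show "coeff (\<Prod>a\<in>{1..n}. [:- x a, 1:]) n = 1"
          using lead_coeff_prod[of "\<lambda>a. [:- x a, 1:]" "{1..n}"] d by simp
      qed
      have "degree Q \<le> n"
        unfolding Q_def by (intro degree_sum_le) (auto intro: order_trans[OF degree_monom_le])
      then have "degree R \<le> n"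
        unfolding R_def using lead(1) by (intro degree_diff_le) (auto intro: order_trans[OF degree_smult_le])
      moreover have "coeff R n = 0"
        using lead(2) by (simp add: R_def Q_def coeff_sum Cn sum.delta if_distrib cong: if_cong)
      \<comment> \<open>The terms of degree \<open>n\<close> cancel. The second alternative is the
        case \<open>n = 0\<close>, in which the degree cannot drop but \<open>R\<close> is a
        constant with coefficient 0.\<close>
      ultimately have dR: "degree R < n \<or> n = 0 \<and> degree R = 0"
        by (metis \<open>R \<noteq> 0\<close> le_neq_implies_less leading_coeff_0_iff)
      have root: "poly R (x a) = 0" if "a \<in> {1..n}" for a
      proof -
        have "poly Q (x a) = 0"
          unfolding Q by (rule rep[OF that]) (use that in \<open>auto simp: y_def\<close>)
        moreover have "poly (\<Prod>a\<in>{1..n}. [:- x a, 1:]) (x a) = 0"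
          using that by (force simp: poly_prod)
        ultimately show ?thesis by (simp add: R_def)
      qed
      have "card (x ` {1..n}) \<le> card {w. poly R w = 0}"
        using root poly_roots_finite[OF \<open>R \<noteq> 0\<close>] by (intro card_mono) auto
      also have "\<dots> \<le> degree R"
        by (rule card_poly_roots_bound[OF \<open>R \<noteq> 0\<close>])
      finally have "n \<le> degree R" using True by (simp add: card_image)
      then show False
        using dR \<open>R \<noteq> 0\<close> \<open>coeff R n = 0\<close> by (metis le_antisym less_le_not_le leading_coeff_0_iff)
    qed
    then have "poly Q (x (Suc n)) = V n x * (\<Prod>a\<in>{1..n}. x (Suc n) - x a)"
      unfolding R_def by (simp add: poly_prod)
    moreover have "y (x (Suc n)) = x" by (simp add: y_def)
    ultimately show ?thesis
      using Q[of "x (Suc n)"] V[of x] by (simp add: M_def V_def)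
  qed
qed

text \<open>
  The sum is the determinant of the matrix with entries
  \<open>\<alpha> a 1 * y a 1 ^ j + \<alpha> a (-1) * y a (-1) ^ j\<close>, which annihilates the coefficient vector of \<open>P\<close>.
\<close>
lemma signed_vandermonde_sum_zero:
  fixes y :: "nat \<Rightarrow> int \<Rightarrow> complex" and \<alpha> :: "nat \<Rightarrow> int \<Rightarrow> complex"
  assumes P: "P \<noteq> 0" "degree P < n"
    and null: "\<And>a. a \<in> {1..n} \<Longrightarrow> \<alpha> a 1 * poly P (y a 1) + \<alpha> a (-1) * poly P (y a (-1)) = 0"
  shows "(\<Sum>\<epsilon>\<in>{1..n} \<rightarrow>\<^sub>E {1, -1}. (\<Prod>a\<in>{1..n}. \<alpha> a (\<epsilon> a)) *
           (\<Prod>a\<in>{1..n}. \<Prod>b\<in>{a<..n}. y b (\<epsilon> b) - y a (\<epsilon> a))) = 0"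
proof -
  define M where "M = Matrix.mat n n (\<lambda>(i, j). \<Sum>e\<in>{1, -1}. \<alpha> (Suc i) e * y (Suc i) e ^ j)"
  have M: "M \<in> carrier_mat n n" by (simp add: M_def)
  define p where "p = Matrix.vec n (coeff P)"
  have p: "p \<in> carrier_vec n" by (simp add: p_def)
  have "p \<noteq> 0\<^sub>v n"
  proof
    assume "p = 0\<^sub>v n"
    then have "p $ degree P = 0" using P(2) by simp
    then show False using P by (simp add: p_def)
  qed
  moreover have "M *\<^sub>v p = 0\<^sub>v n"
  proof (rule eq_vecI)
    fix i assume "i < dim_vec (0\<^sub>v n :: complex Matrix.vec)"
    then have i: "i < n" by simp
    have pol: "(\<Sum>j<n. w ^ j * coeff P j) = poly P w" for w
    proof -
      have "(\<Sum>j<n. w ^ j * coeff P j) = (\<Sum>j\<le>degree P. w ^ j * coeff P j)"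
        by (rule sum.mono_neutral_right) (use P(2) in \<open>auto simp: coeff_eq_0\<close>)
      then show ?thesis by (simp add: poly_altdef mult.commute)
    qed
    have "(M *\<^sub>v p) $ i = (\<Sum>j<n. (\<Sum>e\<in>{1, -1}. \<alpha> (Suc i) e * y (Suc i) e ^ j) * coeff P j)"
      using i by (simp add: M_def p_def scalar_prod_def atLeast0LessThan)
    also have "\<dots> = (\<Sum>e\<in>{1, -1}. \<alpha> (Suc i) e * (\<Sum>j<n. y (Suc i) e ^ j * coeff P j))"
      by (simp add: sum.distrib sum_distrib_left algebra_simps)
    also have "\<dots> = 0"
      using null[of "Suc i"] i by (simp add: pol)
    finally show "(M *\<^sub>v p) $ i = 0\<^sub>v n $ i" using i by simp
  qed (simp add: M_def)
  ultimately have "Determinant.det M = 0"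
    using det_0_iff_vec_prod_zero[OF M] p by blast
  moreover have "Determinant.det M = (\<Sum>\<epsilon>\<in>{1..n} \<rightarrow>\<^sub>E {1, -1}. (\<Prod>a\<in>{1..n}. \<alpha> a (\<epsilon> a)) *
           (\<Prod>a\<in>{1..n}. \<Prod>b\<in>{a<..n}. y b (\<epsilon> b) - y a (\<epsilon> a)))"
  proof -
    have "Determinant.det M = (\<Sum>\<sigma>\<in>{\<sigma>. \<sigma> permutes {0..<n}}. signof \<sigma> *
        (\<Prod>i<n. \<Sum>e\<in>{1, -1}. \<alpha> (Suc i) e * y (Suc i) e ^ \<sigma> i))"
      unfolding det_def'[OF M] atLeast0LessThan
    proof (intro sum.cong refl arg_cong2[where f = "(*)"] prod.cong)
      fix \<sigma> i assume "\<sigma> \<in> {\<sigma>. \<sigma> permutes {..<n}}" "i \<in> {..<n}"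
      moreover from this have "\<sigma> i < n" using permutes_in_image[of \<sigma> "{..<n}" i] by auto
      ultimately show "M $$ (i, \<sigma> i) = (\<Sum>e\<in>{1, -1}. \<alpha> (Suc i) e * y (Suc i) e ^ \<sigma> i)"
        by (simp add: M_def)
    qed
    \<comment> \<open>Multiplying out the sum of two terms in each row produces one summand per
      choice of signs. Matrix rows count from 0 and tuples from 1, whence
      \<open>\<sigma> (a - 1)\<close>.\<close>
    also have "\<dots> = (\<Sum>\<sigma>\<in>{\<sigma>. \<sigma> permutes {0..<n}}. \<Sum>\<epsilon>\<in>{1..n} \<rightarrow>\<^sub>E {1, -1}. signof \<sigma> *
        (\<Prod>a\<in>{1..n}. \<alpha> a (\<epsilon> a) * y a (\<epsilon> a) ^ \<sigma> (a - 1)))"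
    proof (rule sum.cong[OF refl])
      fix \<sigma> :: "nat \<Rightarrow> nat"
      have "(\<Prod>i<n. \<Sum>e\<in>{1, -1}. \<alpha> (Suc i) e * y (Suc i) e ^ \<sigma> i) =
          (\<Prod>a\<in>{1..n}. \<Sum>e\<in>{1, -1}. \<alpha> a e * y a e ^ \<sigma> (a - 1))"
        using prod.atLeast1_atMost_eq[of "\<lambda>a. \<Sum>e\<in>{1, -1}. \<alpha> a e * y a e ^ \<sigma> (a - 1)" n] by simp
      also have "\<dots> = (\<Sum>\<epsilon>\<in>{1..n} \<rightarrow>\<^sub>E {1, -1}. \<Prod>a\<in>{1..n}. \<alpha> a (\<epsilon> a) * y a (\<epsilon> a) ^ \<sigma> (a - 1))"
        by (rule prod_sum_PiE) auto
      finally show "signof \<sigma> * (\<Prod>i<n. \<Sum>e\<in>{1, -1}. \<alpha> (Suc i) e * y (Suc i) e ^ \<sigma> i) =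
          (\<Sum>\<epsilon>\<in>{1..n} \<rightarrow>\<^sub>E {1, -1}. signof \<sigma> * (\<Prod>a\<in>{1..n}. \<alpha> a (\<epsilon> a) * y a (\<epsilon> a) ^ \<sigma> (a - 1)))"
        by (simp only: sum_distrib_left)
    qed
    also have "\<dots> = (\<Sum>\<epsilon>\<in>{1..n} \<rightarrow>\<^sub>E {1, -1}. \<Sum>\<sigma>\<in>{\<sigma>. \<sigma> permutes {0..<n}}. signof \<sigma> *
        (\<Prod>a\<in>{1..n}. \<alpha> a (\<epsilon> a) * y a (\<epsilon> a) ^ \<sigma> (a - 1)))"
      by (rule sum.swap)
    also have "\<dots> = (\<Sum>\<epsilon>\<in>{1..n} \<rightarrow>\<^sub>E {1, -1}. (\<Prod>a\<in>{1..n}. \<alpha> a (\<epsilon> a)) *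
           (\<Prod>a\<in>{1..n}. \<Prod>b\<in>{a<..n}. y b (\<epsilon> b) - y a (\<epsilon> a)))"
    proof (rule sum.cong[OF refl])
      fix \<epsilon> :: "nat \<Rightarrow> int"
      define x where "x a = y a (\<epsilon> a)" for a
      have "(\<Prod>a\<in>{1..n}. \<Prod>b\<in>{a<..n}. x b - x a) =
          (\<Sum>\<sigma>\<in>{\<sigma>. \<sigma> permutes {0..<n}}. signof \<sigma> * (\<Prod>a\<in>{1..n}. x a ^ \<sigma> (a - 1)))"
        unfolding vandermonde_det[symmetric]
          det_def'[OF mat_carrier[of n n "\<lambda>(i, j). x (Suc i) ^ j"]]
      proof (intro sum.cong refl arg_cong2[where f = "(*)"])
        fix \<sigma> assume "\<sigma> \<in> {\<sigma>. \<sigma> permutes {0..<n}}"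
        then have "\<sigma> i < n" if "i < n" for i
          using permutes_in_image[of \<sigma> "{0..<n}" i] that by auto
        then show "(\<Prod>i = 0..<n. Matrix.mat n n (\<lambda>(i, j). x (Suc i) ^ j) $$ (i, \<sigma> i)) = (\<Prod>a\<in>{1..n}. x a ^ \<sigma> (a - 1))"
          using prod.atLeast1_atMost_eq[of "\<lambda>a. x a ^ \<sigma> (a - 1)" n] by (simp add: atLeast0LessThan)
      qed
      then show "(\<Sum>\<sigma>\<in>{\<sigma>. \<sigma> permutes {0..<n}}. signof \<sigma> * (\<Prod>a\<in>{1..n}. \<alpha> a (\<epsilon> a) * y a (\<epsilon> a) ^ \<sigma> (a - 1)))
          = (\<Prod>a\<in>{1..n}. \<alpha> a (\<epsilon> a)) * (\<Prod>a\<in>{1..n}. \<Prod>b\<in>{a<..n}. y b (\<epsilon> b) - y a (\<epsilon> a))"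
        by (simp add: x_def prod.distrib sum_distrib_left mult_ac)
    qed
    finally show ?thesis .
  qed
  ultimately show ?thesis by simp
qed

section \<open>Iterated residues\<close>

lemma cont_holo_compose_coord:
  assumes f: "f holomorphic_on S" and "open S" and \<Omega>: "\<And>u. u \<in> \<Omega> \<Longrightarrow> u i \<in> S"
  shows "cont_holo \<Omega> (\<lambda>u. f (u i))"
  unfolding cont_holo_def
proof (intro conjI ballI allI)
  have "continuous_on \<Omega> (\<lambda>u. u i)"
    by (rule continuous_on_subset[OF continuous_on_product_coordinates]) simp
  then show "continuous_on \<Omega> (\<lambda>u. f (u i))"
    by (rule continuous_on_compose2[OF holomorphic_on_imp_continuous_on[OF f]]) (use \<Omega> in auto)
  fix u j assume "u \<in> \<Omega>"
  then have "f field_differentiable at (u i)"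
    using f \<open>open S\<close> \<Omega> holomorphic_on_imp_differentiable_at by blast
  then show "(\<lambda>w. f ((u(j := w)) i)) field_differentiable at (u j)"
    by (cases "i = j") auto
qed

lemma open_coord_in:
  fixes S :: "complex set"
  assumes "open S"
  shows "open {u :: nat \<Rightarrow> complex. u i \<in> S}"
  using open_vimage[OF assms, of "\<lambda>u. u i"] by (simp add: vimage_def)

lemma open_coord_noteq: "open {u :: nat \<Rightarrow> complex. u i \<noteq> s * u j}"
proof -
  have "continuous_on UNIV (\<lambda>u :: nat \<Rightarrow> complex. u i)" "continuous_on UNIV (\<lambda>u :: nat \<Rightarrow> complex. s * u j)"
    by (auto intro!: continuous_intros)
  then show ?thesis by (rule open_Collect_neq)
qed

text \<open>The product tends to 1 at infinity and has simple poles at the distinct points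
  \<open>x a\<close>; the coefficients are its residues there.\<close>

lemma prod_ratio_partial_fractions:
  fixes x y :: "'b \<Rightarrow> 'a :: field" and w :: 'a
  assumes "finite A" "inj_on x A" "w \<notin> x ` A"
  shows "(\<Prod>a\<in>A. (w - y a) / (w - x a)) =
    1 + (\<Sum>a\<in>A. (x a - y a) * (\<Prod>b\<in>A - {a}. (x a - y b) / (x a - x b)) / (w - x a))"
  using assms
proof (induction A arbitrary: w)
  case (insert c A)
  define C where "C a = (x a - y a) * (\<Prod>b\<in>A - {a}. (x a - y b) / (x a - x b))" for a
  have inj: "inj_on x A" and w: "w \<notin> x ` A" "w \<noteq> x c" and c: "x c \<notin> x ` A"
    using insert.prems insert.hyps by (auto simp: inj_on_def)
  have IH: "(\<Prod>a\<in>A. (w - y a) / (w - x a)) = 1 + (\<Sum>a\<in>A. C a / (w - x a))" if "w \<notin> x ` A" for w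
    using insert.IH[OF inj that] by (simp add: C_def)
  \<comment> \<open>The new ratio, times a simple pole at \<open>x a\<close>, is split into its
    poles at \<open>x a\<close> and \<open>x c\<close>.\<close>
  have *: "(w - y c) / (w - x c) * (C a / (w - x a)) =
      C a * ((x a - y c) / (x a - x c)) / (w - x a) + (x c - y c) / (w - x c) * (C a / (x c - x a))"
    if "a \<in> A" for a
  proof -
    have nz: "w - x a \<noteq> 0" "w - x c \<noteq> 0" "x a - x c \<noteq> 0" "x c - x a \<noteq> 0"
      using that w c by (auto simp: image_iff)
    have "C a / (x c - x a) = - (C a / (x a - x c))"
      by (metis minus_diff_eq minus_divide_right)
    then show ?thesis using nz by (simp add: divide_simps) (simp add: algebra_simps)
  qed
  have "(\<Prod>a\<in>insert c A. (w - y a) / (w - x a)) =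
      (w - y c) / (w - x c) * (1 + (\<Sum>a\<in>A. C a / (w - x a)))"
    using insert.hyps IH[OF w(1)] by simp
  also have "\<dots> = (w - y c) / (w - x c) + (\<Sum>a\<in>A. (w - y c) / (w - x c) * (C a / (w - x a)))"
    by (simp add: distrib_left sum_distrib_left)
  also have "\<dots> = (w - y c) / (w - x c) + (\<Sum>a\<in>A. C a * ((x a - y c) / (x a - x c)) / (w - x a)
      + (x c - y c) / (w - x c) * (C a / (x c - x a)))"
    by (rule arg_cong2[where f = "(+)"], rule refl, rule sum.cong) (use * in auto)
  also have "\<dots> = (w - y c) / (w - x c) + (\<Sum>a\<in>A. C a * ((x a - y c) / (x a - x c)) / (w - x a))
      + (x c - y c) / (w - x c) * (\<Sum>a\<in>A. C a / (x c - x a))"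
    by (simp add: sum.distrib sum_distrib_left)
  also have "(w - y c) / (w - x c) = 1 + (x c - y c) / (w - x c)"
    using w by (simp add: field_simps)
  also have "1 + (x c - y c) / (w - x c) + (\<Sum>a\<in>A. C a * ((x a - y c) / (x a - x c)) / (w - x a))
      + (x c - y c) / (w - x c) * (\<Sum>a\<in>A. C a / (x c - x a)) =
      1 + ((x c - y c) / (w - x c) * (1 + (\<Sum>a\<in>A. C a / (x c - x a)))
        + (\<Sum>a\<in>A. C a * ((x a - y c) / (x a - x c)) / (w - x a)))"
    by (simp add: algebra_simps)
  \<comment> \<open>The contributions collected at the pole \<open>x c\<close> are the induction
    hypothesis evaluated at \<open>w = x c\<close>.\<close>
  also have "1 + (\<Sum>a\<in>A. C a / (x c - x a)) = (\<Prod>a\<in>A. (x c - y a) / (x c - x a))"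
    using IH[OF c] by simp
  also have "(\<Sum>a\<in>A. C a * ((x a - y c) / (x a - x c)) / (w - x a)) =
      (\<Sum>a\<in>A. (x a - y a) * (\<Prod>b\<in>insert c A - {a}. (x a - y b) / (x a - x b)) / (w - x a))"
  proof (rule sum.cong[OF refl])
    fix a assume a: "a \<in> A"
    then have "insert c A - {a} = insert c (A - {a})" "c \<notin> A - {a}"
      using insert.hyps by auto
    then show "C a * ((x a - y c) / (x a - x c)) / (w - x a) =
        (x a - y a) * (\<Prod>b\<in>insert c A - {a}. (x a - y b) / (x a - x b)) / (w - x a)"
      using insert.hyps by (simp add: C_def)
  qed
  finally show ?case
    using insert.hyps by simp
qed simp

text \<open>For \<open>a\<close> outside \<open>B\<close> and distinct points, this is the residue
  at \<open>x a\<close> of the product of (v - s x_b) / (v - x_b) over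
  \<open>insert a B\<close>.\<close>

definition residue_coeff :: "complex \<Rightarrow> ('b \<Rightarrow> complex) \<Rightarrow> 'b set \<Rightarrow> 'b \<Rightarrow> complex" where
  "residue_coeff s x B a = (1 - s) * x a * (\<Prod>b\<in>B. (x a - s * x b) / (x a - x b))"

text \<open>In the outermost variable the integrand is \<open>R w * g w\<close>, where
  \<open>g\<close> contains the inner integral and is holomorphic on and inside the contour: a
  kernel pole would need \<open>v = s * w\<close> with \<open>v\<close> on an inner contour. Partial
  fractions of \<open>R\<close> reduce everything to Cauchy's formula at the points
  \<open>x a\<close>.\<close>

lemma iterated_integral_residue_step:
  fixes \<gamma> :: "nat \<Rightarrow> real \<Rightarrow> complex" and s :: complex and x :: "'b \<Rightarrow> complex"
    and \<phi> :: "nat \<Rightarrow> complex \<Rightarrow> complex"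
  defines "K \<equiv> \<lambda>(i::nat) (j::nat) v w. (v - w) / (v - s * w)"
  defines "E \<equiv> \<lambda>m A u. iterated_integral \<gamma> (rev [1..<Suc m])
      (pair_product K (\<lambda>i v. \<phi> i v * (\<Prod>a\<in>A. (v - s * x a) / (v - x a))) {1..m}) u"
  assumes A: "finite A" "inj_on x A"
    and \<gamma>: "\<And>i. i \<in> {1..Suc m} \<Longrightarrow> ccw_around_origin (\<gamma> i)"
    and S: "\<And>i. i \<in> {1..Suc m} \<Longrightarrow> open (S i) \<and> \<phi> i holomorphic_on S i \<and>
              path_image (\<gamma> i) \<union> inside (path_image (\<gamma> i)) \<subseteq> S i"
    and x: "\<And>i a. i \<in> {1..Suc m} \<Longrightarrow> a \<in> A \<Longrightarrow> x a \<in> inside (path_image (\<gamma> i))"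
    and kern: "\<And>i j v w. i \<in> {1..Suc m} \<Longrightarrow> j \<in> {1..Suc m} \<Longrightarrow> i < j \<Longrightarrow> v \<in> path_image (\<gamma> i) \<Longrightarrow>
              w \<in> path_image (\<gamma> j) \<union> inside (path_image (\<gamma> j)) \<Longrightarrow> v \<noteq> s * w"
  shows "E (Suc m) A u = (\<Sum>a\<in>A. 2 * of_real pi * \<i> * \<phi> (Suc m) (x a) * residue_coeff s x (A - {a}) a * E m (A - {a}) u)"
proof -
  let ?xs = "rev [1..<Suc m]"
  define R where "R v = (\<Prod>a\<in>A. (v - s * x a) / (v - x a))" for v
  define F where "F u = pair_product K (\<lambda>i v. \<phi> i v * R v * K i (Suc m) v (u (Suc m))) {1..m} u" for u
  define \<Psi> where "\<Psi> w = iterated_integral \<gamma> ?xs F (u(Suc m := w))" for w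
  \<comment> \<open>The points \<open>x a\<close> are excluded for the inner variables only; the
    outermost variable must be free to take these values.\<close>
  define \<Omega> where "\<Omega> = (\<Inter>i\<in>{1..m}. {u. u i \<in> S i - x ` A}) \<inter> (\<Inter>i\<in>{1..Suc m}. \<Inter>j\<in>{i<..Suc m}. {u. u i \<noteq> s * u j})"
  define T where "T = {w. u(Suc m := w) \<in> reach \<gamma> ?xs \<Omega>} \<inter> S (Suc m)"
  let ?g = "\<gamma> (Suc m)"
  let ?D = "path_image ?g \<union> inside (path_image ?g)"
  have \<gamma>': "valid_path (\<gamma> i)" "pathfinish (\<gamma> i) = pathstart (\<gamma> i)" "path (\<gamma> i)" if "i \<in> {1..Suc m}" for i
    using \<gamma>[OF that] by (auto simp: ccw_around_origin_def valid_path_imp_path)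
  have xs: "set ?xs = {1..m}" by auto
  have notx: "v \<noteq> x a" if "i \<in> {1..Suc m}" "v \<in> path_image (\<gamma> i)" "a \<in> A" for i v a
    using x[OF that(1,3)] that(2) inside_no_overlap[of "path_image (\<gamma> i)"] by (metis IntI empty_iff)
  have open_\<Omega>: "open \<Omega>"
    unfolding \<Omega>_def using S A(1)
    by (intro open_Int open_INT finite_atLeastAtMost finite_greaterThanAtMost ballI open_coord_noteq
         open_coord_in open_Diff) (auto intro: finite_imp_closed)
  have F_holo: "cont_holo \<Omega> F"
  proof -
    have c: "cont_holo \<Omega> (\<lambda>u. K i j (u i) (u j))" if "i \<in> {1..Suc m}" "j \<in> {i<..Suc m}" for i j
      unfolding K_def
      by (intro cont_holo_divide cont_holo_diff cont_holo_mult cont_holo_const cont_holo_coord)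
         (use that in \<open>auto simp: \<Omega>_def\<close>)
    have "cont_holo \<Omega> (\<lambda>u. \<phi> i (u i))" if "i \<in> {1..m}" for i
      by (rule cont_holo_compose_coord[of _ "S i"]) (use S[of i] that in \<open>auto simp: \<Omega>_def\<close>)
    moreover have "cont_holo \<Omega> (\<lambda>u. R (u i))" if "i \<in> {1..m}" for i
      unfolding R_def
      by (intro cont_holo_prod cont_holo_divide cont_holo_diff cont_holo_const cont_holo_coord)
         (use that in \<open>auto simp: \<Omega>_def\<close>)
    ultimately show ?thesis
      unfolding F_def pair_product_def
      by (intro cont_holo_mult cont_holo_prod c) auto
  qed
  have T_open: "open T"
    unfolding T_def using S[of "Suc m"]
    by (intro open_Int open_slice open_reach open_\<Omega>) (auto intro: \<gamma>')
  have D_T: "?D \<subseteq> T"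
  proof
    fix w assume w: "w \<in> ?D"
    have "u(Suc m := w) \<in> reach \<gamma> ?xs \<Omega>"
    proof (rule in_reachI)
      fix v assume v: "\<And>i. i \<in> set ?xs \<Longrightarrow> v i \<in> path_image (\<gamma> i)" "\<And>i. i \<notin> set ?xs \<Longrightarrow> v i = (u(Suc m := w)) i"
      have 1: "v i \<in> path_image (\<gamma> i)" if "i \<in> {1..m}" for i
        using v(1)[of i] that xs by blast
      have 2: "v j \<in> path_image (\<gamma> j) \<union> inside (path_image (\<gamma> j))" if "j \<in> {1..Suc m}" for j
        using v(2)[of j] 1[of j] w that by (cases "j = Suc m") auto
      show "v \<in> \<Omega>"
        unfolding \<Omega>_def
      proof (intro IntI INT_I)
        show "v \<in> {u. u i \<in> S i - x ` A}" if "i \<in> {1..m}" for i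
          using 1[OF that] S[of i] notx[of i] that by auto
        show "v \<in> {u. u i \<noteq> s * u j}" if "i \<in> {1..Suc m}" "j \<in> {i<..Suc m}" for i j
          using kern[of i j "v i" "v j"] 1[of i] 2[of j] that by auto
      qed
    qed
    then show "w \<in> T" using w S[of "Suc m"] by (auto simp: T_def)
  qed
  define g where "g w = \<phi> (Suc m) w * \<Psi> w" for w
  have "\<Psi> holomorphic_on T"
    unfolding \<Psi>_def
    by (rule cont_holo_slice[OF cont_holo_iterated_integral[OF F_holo open_\<Omega>]])
       (use \<gamma>' in \<open>auto simp: T_def\<close>)
  then have g: "g holomorphic_on T"
    unfolding g_def using S[of "Suc m"]
    by (intro holomorphic_intros) (auto simp: T_def elim: holomorphic_on_subset)
  \<comment> \<open>The global forms of Cauchy's theorem and formula ask that the contour not wind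
    around points off \<open>T\<close>; such points are outside it because \<open>T\<close> contains
    the contour and its inside.\<close>
  have wn: "winding_number ?g w = 0" if "w \<notin> T" for w
  proof -
    have "w \<in> outside (path_image ?g)"
      using that D_T inside_Un_outside[of "path_image ?g"] by blast
    then show ?thesis
      using winding_number_zero_in_outside \<gamma>' by auto
  qed
  have int_g: "(g has_contour_integral 0) ?g"
    by (rule Cauchy_theorem_global[OF T_open g]) (use \<gamma>' D_T wn in auto)
  have int_pole: "((\<lambda>w. g w / (w - x a)) has_contour_integral (2 * of_real pi * \<i> * g (x a))) ?g" if "a \<in> A" for a
  proof -
    have xa: "x a \<in> inside (path_image ?g)" using x that by auto
    have "((\<lambda>w. g w / (w - x a)) has_contour_integral (2 * pi * \<i> * winding_number ?g (x a) * g (x a))) ?g"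
      by (rule Cauchy_integral_formula_global[OF T_open g])
         (use \<gamma>'[of "Suc m"] D_T wn xa notx[of "Suc m" "x a" a] that in auto)
    then show ?thesis
      using ccw_winding_number_inside[OF \<gamma> xa] by simp
  qed
  have split: "iterated_integral \<gamma> ?xs (pair_product K (\<lambda>i v. \<phi> i v * R v) {1..Suc m}) (u(Suc m := w))
      = R w * g w" for w
  proof -
    have "iterated_integral \<gamma> ?xs (pair_product K (\<lambda>i v. \<phi> i v * R v) {1..Suc m}) (u(Suc m := w)) =
        iterated_integral \<gamma> ?xs (\<lambda>v. \<phi> (Suc m) w * R w * F v) (u(Suc m := w))"
    proof (rule iterated_integral_cong)
      fix v assume "\<And>i. i \<notin> set ?xs \<Longrightarrow> v i = (u(Suc m := w)) i"
      from this[of "Suc m"] have "v (Suc m) = w" by simp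
      moreover have "{1..Suc m} = insert (Suc m) {1..m}" by auto
      ultimately show "pair_product K (\<lambda>i v. \<phi> i v * R v) {1..Suc m} v = \<phi> (Suc m) w * R w * F v"
        using pair_product_insert[of "{1..m}" "Suc m" K "\<lambda>i v. \<phi> i v * R v" v] by (simp add: F_def)
    qed
    then show ?thesis
      by (simp add: iterated_integral_cmult g_def \<Psi>_def)
  qed
  have "E (Suc m) A u = contour_integral ?g (\<lambda>w. iterated_integral \<gamma> ?xs (pair_product K (\<lambda>i v. \<phi> i v * R v) {1..Suc m}) (u(Suc m := w)))"
    by (simp add: E_def R_def)
  also have "\<dots> = contour_integral ?g (\<lambda>w. R w * g w)"
    by (simp only: split)
  also have "\<dots> = contour_integral ?g (\<lambda>w. g w + (\<Sum>a\<in>A. residue_coeff s x (A - {a}) a * (g w / (w - x a))))"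
  proof (rule contour_integral_cong[OF refl])
    fix w assume "w \<in> path_image ?g"
    then have "w \<notin> x ` A" using notx[of "Suc m"] by auto
    then have "R w = 1 + (\<Sum>a\<in>A. residue_coeff s x (A - {a}) a / (w - x a))"
      unfolding R_def using prod_ratio_partial_fractions[OF A, of w "\<lambda>a. s * x a"]
      by (simp add: residue_coeff_def algebra_simps)
    then show "R w * g w = g w + (\<Sum>a\<in>A. residue_coeff s x (A - {a}) a * (g w / (w - x a)))"
      by (simp add: distrib_right sum_distrib_right)
  qed
  also have "\<dots> = 0 + (\<Sum>a\<in>A. residue_coeff s x (A - {a}) a * (2 * of_real pi * \<i> * g (x a)))"
    by (intro contour_integral_unique has_contour_integral_add int_g has_contour_integral_sum A
         has_contour_integral_lmul int_pole)
  also have "\<dots> = (\<Sum>a\<in>A. 2 * of_real pi * \<i> * \<phi> (Suc m) (x a) * residue_coeff s x (A - {a}) a * E m (A - {a}) u)"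
    unfolding add_0
  proof (rule sum.cong[OF refl])
    fix a assume a: "a \<in> A"
    let ?G = "pair_product K (\<lambda>i v. \<phi> i v * (\<Prod>a\<in>A - {a}. (v - s * x a) / (v - x a))) {1..m}"
    have "\<Psi> (x a) = iterated_integral \<gamma> ?xs ?G (u(Suc m := x a))"
      unfolding \<Psi>_def
    proof (rule iterated_integral_cong)
      fix v assume v: "\<And>i. i \<in> set ?xs \<Longrightarrow> v i \<in> path_image (\<gamma> i)" "\<And>i. i \<notin> set ?xs \<Longrightarrow> v i = (u(Suc m := x a)) i"
      have vm: "v (Suc m) = x a" using v(2)[of "Suc m"] by simp
      show "F v = ?G v"
        unfolding F_def vm
      proof (rule pair_product_cong[OF _ refl])
        fix i assume i: "i \<in> {1..m}"
        then have vi: "v i \<in> path_image (\<gamma> i)" using v(1)[of i] xs by blast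
        have 1: "v i \<noteq> x a" using notx[of i] vi i a by auto
        \<comment> \<open>Neither \<open>v i - x a\<close> nor \<open>v i - s * x a\<close> is 0, so
          the kernel at \<open>w = x a\<close> cancels the ratio belonging to \<open>a\<close>
          exactly, leaving the product over \<open>A - {a}\<close>.\<close>
        have 2: "v i \<noteq> s * x a"
          by (rule kern[of i "Suc m"]) (use vi i x[of "Suc m" a] a in auto)
        have "R (v i) = (v i - s * x a) / (v i - x a) * (\<Prod>a\<in>A - {a}. (v i - s * x a) / (v i - x a))"
          unfolding R_def using A(1) a by (rule prod.remove)
        then show "\<phi> i (v i) * R (v i) * K i (Suc m) (v i) (x a) =
            \<phi> i (v i) * (\<Prod>a\<in>A - {a}. (v i - s * x a) / (v i - x a))"
          using 1 2 by (simp add: K_def)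
      qed
    qed
    also have "\<dots> = E m (A - {a}) u"
      unfolding E_def by (rule iterated_integral_indep[where X = "{}" and xs = ?xs, unfolded xs], rule pair_product_cong) auto
    finally show "residue_coeff s x (A - {a}) a * (2 * of_real pi * \<i> * g (x a)) =
        2 * of_real pi * \<i> * \<phi> (Suc m) (x a) * residue_coeff s x (A - {a}) a * E m (A - {a}) u"
      by (simp add: g_def)
  qed
  finally show ?thesis .
qed

text \<open>The value at the largest index records the pole chosen for the outermost variable; the
  rest of the injection records the poles of the inner ones.\<close>

lemma sum_injections_Suc:
  fixes h :: "(nat \<Rightarrow> 'b) \<Rightarrow> 'c::comm_monoid_add"
  assumes "finite A"
  shows "(\<Sum>f\<in>{f \<in> {1..Suc m} \<rightarrow>\<^sub>E A. inj_on f {1..Suc m}}. h f) =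
    (\<Sum>c\<in>A. \<Sum>f\<in>{f \<in> {1..m} \<rightarrow>\<^sub>E A - {c}. inj_on f {1..m}}. h (f(Suc m := c)))"
proof -
  have fin: "finite {f \<in> {1..m} \<rightarrow>\<^sub>E A - {c}. inj_on f {1..m}}" for c
    using assms by (intro finite_subset[OF _ finite_PiE[of "{1..m}" "\<lambda>_. A - {c}"]]) auto
  have eq: "{1..Suc m} = insert (Suc m) {1..m}" by auto
  show ?thesis
    unfolding sum.Sigma[OF assms ballI[OF fin]]
  proof (rule sum.reindex_bij_witness[where j = "\<lambda>f. (f (Suc m), restrict f {1..m})"
        and i = "\<lambda>(c, f). f(Suc m := c)"])
    fix f assume f: "f \<in> {f \<in> {1..Suc m} \<rightarrow>\<^sub>E A. inj_on f {1..Suc m}}"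
    show 1: "(case (f (Suc m), restrict f {1..m}) of (c, f) \<Rightarrow> f(Suc m := c)) = f"
    proof (rule ext)
      fix i show "(case (f (Suc m), restrict f {1..m}) of (c, f) \<Rightarrow> f(Suc m := c)) i = f i"
        using f PiE_arb[of f "{1..Suc m}" "\<lambda>_. A" i] by (cases "i = Suc m") (auto simp: restrict_def)
    qed
    show "(f (Suc m), restrict f {1..m}) \<in> (SIGMA c:A. {f \<in> {1..m} \<rightarrow>\<^sub>E A - {c}. inj_on f {1..m}})"
    proof -
      have mem: "f i \<in> A" if "i \<in> {1..Suc m}" for i
        using PiE_mem[of f "{1..Suc m}" "\<lambda>_. A" i] f that by simp
      have inj: "inj_on f {1..Suc m}" using f by simp
      have ne: "f i \<noteq> f (Suc m)" if "i \<in> {1..m}" for i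
      proof
        assume "f i = f (Suc m)"
        then have "i = Suc m" by (rule inj_onD[OF inj]) (use that in simp_all)
        then show False using that by simp
      qed
      have "restrict f {1..m} \<in> {1..m} \<rightarrow>\<^sub>E A - {f (Suc m)}"
        using mem ne by (intro restrict_PiE_iff[THEN iffD2] ballI) simp
      moreover have "inj_on (restrict f {1..m}) {1..m}"
        unfolding inj_on_restrict_eq by (rule inj_on_subset[OF inj]) simp
      ultimately show ?thesis using mem[of "Suc m"] by simp
    qed
    show "(case (f (Suc m), restrict f {1..m}) of (c, f) \<Rightarrow> h (f(Suc m := c))) = h f"
      using 1 by simp
  next
    fix p assume "p \<in> (SIGMA c:A. {f \<in> {1..m} \<rightarrow>\<^sub>E A - {c}. inj_on f {1..m}})"
    then obtain c f where p: "p = (c, f)" and c: "c \<in> A" and f: "f \<in> {1..m} \<rightarrow>\<^sub>E A - {c}" "inj_on f {1..m}"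
      by auto
    have "restrict (f(Suc m := c)) {1..m} = f"
    proof (rule ext)
      fix i show "restrict (f(Suc m := c)) {1..m} i = f i"
        using PiE_arb[OF f(1), of i] by (cases "i \<in> {1..m}") (simp_all add: restrict_def)
    qed
    then show "(\<lambda>f. (f (Suc m), restrict f {1..m})) (case p of (c, f) \<Rightarrow> f(Suc m := c)) = p"
      using p by simp
    have "f(Suc m := c) \<in> {1..Suc m} \<rightarrow>\<^sub>E A"
    proof (rule PiE_I)
      fix i assume "i \<in> {1..Suc m}"
      then show "(f(Suc m := c)) i \<in> A"
        using PiE_mem[OF f(1), of i] c by (cases "i = Suc m") simp_all
    next
      fix i assume "i \<notin> {1..Suc m}"
      then show "(f(Suc m := c)) i = undefined"
        using PiE_arb[OF f(1), of i] by auto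
    qed
    moreover have "inj_on (f(Suc m := c)) {1..Suc m}"
    proof -
      have c_notin: "c \<notin> f ` {1..m}"
      proof
        assume "c \<in> f ` {1..m}"
        then obtain i where "i \<in> {1..m}" "c = f i" by (elim imageE)
        then show False using PiE_mem[OF f(1), of i] by simp
      qed
      have "(f(Suc m := c)) ` ({1..m} - {Suc m}) = f ` {1..m}"
        by (intro image_cong) simp_all
      then show ?thesis
        unfolding eq inj_on_insert using inj_on_fun_updI[OF f(2) c_notin] c_notin by simp
    qed
    ultimately show "(case p of (c, f) \<Rightarrow> f(Suc m := c)) \<in> {f \<in> {1..Suc m} \<rightarrow>\<^sub>E A. inj_on f {1..Suc m}}"
      using p by simp
  qed
qed

text \<open>Variables are integrated from the largest index down, each using up one point. At
  variable \<open>i\<close> the image of \<open>{i..m}\<close> under \<open>f\<close> consists of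
  the points used by the outer variables and the current one, and the remaining points enter the
  residue. If \<open>A\<close> has fewer than \<open>m\<close> points, there are no injections and
  the integral is 0.\<close>

lemma iterated_integral_residues:
  fixes \<gamma> :: "nat \<Rightarrow> real \<Rightarrow> complex" and s :: complex and x :: "'b \<Rightarrow> complex"
    and \<phi> :: "nat \<Rightarrow> complex \<Rightarrow> complex"
  defines "K \<equiv> \<lambda>(i::nat) (j::nat) v w. (v - w) / (v - s * w)"
  assumes "finite A" "inj_on x A"
    and "\<And>i. i \<in> {1..m} \<Longrightarrow> ccw_around_origin (\<gamma> i)"
    and "\<And>i. i \<in> {1..m} \<Longrightarrow> open (S i) \<and> \<phi> i holomorphic_on S i \<and>
              path_image (\<gamma> i) \<union> inside (path_image (\<gamma> i)) \<subseteq> S i"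
    and "\<And>i a. i \<in> {1..m} \<Longrightarrow> a \<in> A \<Longrightarrow> x a \<in> inside (path_image (\<gamma> i))"
    and "\<And>i j v w. i \<in> {1..m} \<Longrightarrow> j \<in> {1..m} \<Longrightarrow> i < j \<Longrightarrow> v \<in> path_image (\<gamma> i) \<Longrightarrow>
              w \<in> path_image (\<gamma> j) \<union> inside (path_image (\<gamma> j)) \<Longrightarrow> v \<noteq> s * w"
  shows "iterated_integral \<gamma> (rev [1..<Suc m])
      (pair_product K (\<lambda>i v. \<phi> i v * (\<Prod>a\<in>A. (v - s * x a) / (v - x a))) {1..m}) u =
    (\<Sum>f\<in>{f \<in> {1..m} \<rightarrow>\<^sub>E A. inj_on f {1..m}}.
       \<Prod>i\<in>{1..m}. 2 * of_real pi * \<i> * \<phi> i (x (f i)) * residue_coeff s x (A - f ` {i..m}) (f i))"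
  using assms(2-)
proof (induction m arbitrary: A)
  case 0
  have "{f. f = (\<lambda>i::nat. undefined :: 'b)} = {\<lambda>i. undefined}" by auto
  then show ?case by (simp add: pair_product_def)
next
  case (Suc m)
  let ?T = "\<lambda>m A f i. 2 * of_real pi * \<i> * \<phi> i (x (f i)) * residue_coeff s x (A - f ` {i..m}) (f i)"
  have step: "(\<Prod>i\<in>{1..Suc m}. ?T (Suc m) A (f(Suc m := c)) i) =
      2 * of_real pi * \<i> * \<phi> (Suc m) (x c) * residue_coeff s x (A - {c}) c * (\<Prod>i\<in>{1..m}. ?T m (A - {c}) f i)" for f c
  proof -
    have "A - (f(Suc m := c)) ` {i..Suc m} = A - {c} - f ` {i..m}" if "i \<in> {1..m}" for i
    proof -
      have "{i..Suc m} = insert (Suc m) {i..m}" using that by auto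
      then show ?thesis by auto
    qed
    then have "(\<Prod>i\<in>{1..m}. ?T (Suc m) A (f(Suc m := c)) i) = (\<Prod>i\<in>{1..m}. ?T m (A - {c}) f i)"
      by (intro prod.cong) auto
    then show ?thesis by simp
  qed
  have IH: "iterated_integral \<gamma> (rev [1..<Suc m])
      (pair_product K (\<lambda>i v. \<phi> i v * (\<Prod>a\<in>A - {c}. (v - s * x a) / (v - x a))) {1..m}) u =
    (\<Sum>f\<in>{f \<in> {1..m} \<rightarrow>\<^sub>E A - {c}. inj_on f {1..m}}. \<Prod>i\<in>{1..m}. ?T m (A - {c}) f i)" for c
  proof (rule Suc.IH)
    show "inj_on x (A - {c})" using Suc.prems(2) by (rule inj_on_subset) auto
    show "v \<noteq> s * w" if "i \<in> {1..m}" "j \<in> {1..m}" "i < j" "v \<in> path_image (\<gamma> i)"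
        "w \<in> path_image (\<gamma> j) \<union> inside (path_image (\<gamma> j))" for i j v w
      by (rule Suc.prems(6)[of i j]) (use that in auto)
    show "ccw_around_origin (\<gamma> i)" if "i \<in> {1..m}" for i
      by (rule Suc.prems(3)) (use that in simp)
    show "open (S i) \<and> \<phi> i holomorphic_on S i \<and> path_image (\<gamma> i) \<union> inside (path_image (\<gamma> i)) \<subseteq> S i"
      if "i \<in> {1..m}" for i
      by (rule Suc.prems(4)) (use that in simp)
    show "x a \<in> inside (path_image (\<gamma> i))" if "i \<in> {1..m}" "a \<in> A - {c}" for i a
      by (rule Suc.prems(5)) (use that in simp_all)
    show "finite (A - {c})" using Suc.prems(1) by simp
  qed
  let ?E = "\<lambda>m A. iterated_integral \<gamma> (rev [1..<Suc m])
      (pair_product K (\<lambda>i v. \<phi> i v * (\<Prod>a\<in>A. (v - s * x a) / (v - x a))) {1..m}) u"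
  have "?E (Suc m) A = (\<Sum>c\<in>A. 2 * of_real pi * \<i> * \<phi> (Suc m) (x c) * residue_coeff s x (A - {c}) c * ?E m (A - {c}))"
    unfolding K_def
    by (rule iterated_integral_residue_step[where S = S]) (fact Suc.prems)+
  also have "\<dots> = (\<Sum>c\<in>A. \<Sum>f\<in>{f \<in> {1..m} \<rightarrow>\<^sub>E A - {c}. inj_on f {1..m}}.
      \<Prod>i\<in>{1..Suc m}. ?T (Suc m) A (f(Suc m := c)) i)"
    by (rule sum.cong[OF refl]) (simp only: IH step sum_distrib_left)
  also have "\<dots> = (\<Sum>f\<in>{f \<in> {1..Suc m} \<rightarrow>\<^sub>E A. inj_on f {1..Suc m}}. \<Prod>i\<in>{1..Suc m}. ?T (Suc m) A f i)"
    by (rule sum_injections_Suc[OF Suc.prems(1), symmetric])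
  finally show ?case .
qed

section \<open>The contour integral of the theorem\<close>

text \<open>All of the integrand that depends on a single variable, with the measure 1 / (2 pi i v)
  included. Here \<open>m\<close> is the sign of the variable and \<open>\<kappa>\<close> the
  associated position in \<open>z\<close>.\<close>

definition variable_factor ::
  "complex \<Rightarrow> complex \<Rightarrow> nat \<Rightarrow> nat \<Rightarrow> nat \<Rightarrow> int \<Rightarrow> (nat \<Rightarrow> int) \<Rightarrow> (nat \<Rightarrow> complex) \<Rightarrow> (nat \<Rightarrow> complex) \<Rightarrow> complex \<Rightarrow> complex"
where
  "variable_factor q k n l \<kappa> m \<epsilon> t z v =
     1 / (2 * of_real pi * \<i> * v)
     * (v * (z \<kappa> - q powr (of_int m - 2 - k) * v) / ((z \<kappa> - q powr (-1 - k) * v) * (v - q powr (k + 3) * z \<kappa>)))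
     * (\<Prod>i\<in>{1..<\<kappa>}. (z i - q powr (of_int m - 2 - k) * v) / (z i - q powr (-1 - k) * v))
     * (\<Prod>i\<in>{\<kappa><..n}. (v - q powr (k + 2 - of_int m) * z i) / (v - q powr (k + 3) * z i))
     * (\<Prod>a\<in>{1..l}. (v - q powr (- of_int m * (k + 1) - of_int (\<epsilon> a)) * t a) / (v - q powr (- of_int m * (k + 2)) * t a))"

text \<open>The shape left for sign 1 after cancellation: one simple pole times ratios of monic
  linear factors, so that \<open>unital_on\<close> applies as soon as the poles are inside.\<close>

definition plus_factor ::
  "complex \<Rightarrow> complex \<Rightarrow> nat \<Rightarrow> nat \<Rightarrow> nat \<Rightarrow> (nat \<Rightarrow> int) \<Rightarrow> (nat \<Rightarrow> complex) \<Rightarrow> (nat \<Rightarrow> complex) \<Rightarrow> complex \<Rightarrow> complex"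
where
  "plus_factor q k n l \<kappa> \<epsilon> t z v =
     1 / (2 * of_real pi * \<i> * (v - q powr (k + 3) * z \<kappa>))
     * (\<Prod>i\<in>{\<kappa><..n}. (v - q powr (k + 1) * z i) / (v - q powr (k + 3) * z i))
     * (\<Prod>a\<in>{1..l}. (v - q powr (- (k + 1) - of_int (\<epsilon> a)) * t a) / (v - q powr (- (k + 2)) * t a))"

text \<open>The part for sign -1 that is free of \<open>t\<close> and \<epsilon>. Its poles are at
  the points q^(k+1) z_i; each factor q^(-2) arises from making the linear factors in
  \<open>v\<close> monic.\<close>

definition minus_factor :: "complex \<Rightarrow> complex \<Rightarrow> nat \<Rightarrow> (nat \<Rightarrow> complex) \<Rightarrow> complex \<Rightarrow> complex" where
  "minus_factor q k \<kappa> z v =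
     q powr (-2) / (2 * of_real pi * \<i> * (v - q powr (k + 1) * z \<kappa>))
     * (\<Prod>i\<in>{1..<\<kappa>}. q powr (-2) * (v - q powr (k + 3) * z i) / (v - q powr (k + 1) * z i))"

definition t_factor :: "complex \<Rightarrow> complex \<Rightarrow> nat \<Rightarrow> (nat \<Rightarrow> int) \<Rightarrow> (nat \<Rightarrow> complex) \<Rightarrow> complex \<Rightarrow> complex" where
  "t_factor q k l \<epsilon> t v =
     (\<Prod>a\<in>{1..l}. (v - q powr (k + 1 - of_int (\<epsilon> a)) * t a) / (v - q powr (k + 2) * t a))"

definition t_prefactor :: "complex \<Rightarrow> nat \<Rightarrow> (nat \<Rightarrow> int) \<Rightarrow> (nat \<Rightarrow> complex) \<Rightarrow> complex" where
  "t_prefactor q l \<epsilon> t =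
     (\<Prod>a\<in>{1..l}. \<Prod>b\<in>{a<..l}. (q powr of_int (\<epsilon> b) * t b - q powr of_int (\<epsilon> a) * t a) / (t b - q powr (-2) * t a))"

definition sign_kernel :: "complex \<Rightarrow> (nat \<Rightarrow> int) \<Rightarrow> nat \<Rightarrow> nat \<Rightarrow> complex \<Rightarrow> complex \<Rightarrow> complex" where
  "sign_kernel q \<mu> i j v y = (v - q powr (of_int (\<mu> i) - of_int (\<mu> j)) * y) / (v - q powr (-2) * y)"

lemma integrand_eq_pair_product:
  "(\<Prod>j\<in>{1..l}. 1 / (2 * of_real pi * \<i> * u j)) * G_integrand q k n l \<nu> \<epsilon> \<mu> t z u =
   t_prefactor q l \<epsilon> t *
   pair_product (sign_kernel q \<mu>) (\<lambda>i. variable_factor q k n l (kth (level_set n \<nu> 0) i) (\<mu> i) \<epsilon> t z) {1..l} u"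
proof -
  have "(\<Prod>j\<in>{1..l} \<inter> {i<..}. h j) = (\<Prod>j\<in>{i<..l}. h j)" if "i \<in> {1..l}" for i and h :: "nat \<Rightarrow> complex"
    by (rule prod.cong) (use that in auto)
  then show ?thesis
    unfolding G_integrand_def G_hat_def Let_def pair_product_def variable_factor_def prod.distrib
      t_prefactor_def sign_kernel_def
    by (simp add: mult_ac)
qed

text \<open>For sign 1 the exponents -1 - k of numerator and denominator agree. Since a quotient
  with denominator 0 is 0, the cancellation holds only off the cancelled points, which is why
  \<open>v\<close> has to avoid them.\<close>

lemma variable_factor_plus:
  assumes q: "q \<noteq> 0" and v: "v \<noteq> 0" "\<And>m. m \<in> {1..n} \<Longrightarrow> v \<noteq> q powr (k + 1) * z m" and \<kappa>: "\<kappa> \<in> {1..n}"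
  shows "variable_factor q k n l \<kappa> 1 \<epsilon> t z v = plus_factor q k n l \<kappa> \<epsilon> t z v"
proof -
  define p where "p = q powr (k + 1)"
  have p: "p \<noteq> 0" using q by (simp add: p_def)
  have e: "q powr (-1 - k) = 1 / p"
    unfolding p_def inverse_eq_divide[symmetric] powr_minus[symmetric]
    by (rule arg_cong2[where f = "(powr)"]) (simp_all add: algebra_simps)
  have nz: "z m - 1 / p * v \<noteq> 0" if "m \<in> {1..n}" for m
    using v(2)[OF that] p by (auto simp: p_def field_simps)
  have 1: "(\<Prod>i\<in>{1..<\<kappa>}. (z i - q powr (-1 - k) * v) / (z i - q powr (-1 - k) * v)) = 1"
    unfolding e by (rule prod.neutral) (use nz \<kappa> in auto)
  have 2: "of_int 1 - 2 - k = -1 - k" "k + 2 - of_int 1 = k + 1" "- of_int 1 * c = - c" for c :: complex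
    by simp_all
  have 3: "1 / (2 * of_real pi * \<i> * v) * (v * (z \<kappa> - q powr (-1 - k) * v) / ((z \<kappa> - q powr (-1 - k) * v) * (v - y)))
      = 1 / (2 * of_real pi * \<i> * (v - y))" for y
    unfolding e using nz[OF \<kappa>] v(1) by simp
  show ?thesis
    unfolding variable_factor_def plus_factor_def 2 1 3 mult_1_right ..
qed

lemma variable_factor_minus:
  assumes q: "q \<noteq> 0" and \<kappa>: "\<kappa> \<in> {1..n}"
    and v: "v \<noteq> 0" "\<And>m. m \<in> {1..n} \<Longrightarrow> v \<noteq> q powr (k + 1) * z m \<and> v \<noteq> q powr (k + 3) * z m"
  shows "variable_factor q k n l \<kappa> (-1) \<epsilon> t z v = minus_factor q k \<kappa> z v * t_factor q k l \<epsilon> t v"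
proof -
  define p1 where "p1 = q powr (k + 1)"
  define p3 where "p3 = q powr (k + 3)"
  have p: "p1 \<noteq> 0" "p3 \<noteq> 0" using q by (simp_all add: p1_def p3_def)
  have e1: "q powr (-1 - k) = 1 / p1"
    unfolding p1_def inverse_eq_divide[symmetric] powr_minus[symmetric]
    by (rule arg_cong2[where f = "(powr)"]) (simp_all add: algebra_simps)
  have e3: "q powr (of_int (-1) - 2 - k) = 1 / p3"
    unfolding p3_def inverse_eq_divide[symmetric] powr_minus[symmetric]
    by (rule arg_cong2[where f = "(powr)"]) (simp_all add: algebra_simps)
  have e2: "q powr (-2) = p1 / p3"
    by (simp add: p1_def p3_def powr_diff[symmetric])
  have nz: "v - p1 * z m \<noteq> 0" "v - p3 * z m \<noteq> 0" "z m - 1 / p1 * v \<noteq> 0" if "m \<in> {1..n}" for m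
    using v(2)[OF that] p by (auto simp: p1_def p3_def field_simps)
  have ratio: "(z m - 1 / p3 * v) / (z m - 1 / p1 * v) = p1 / p3 * (v - p3 * z m) / (v - p1 * z m)"
    if "m \<in> {1..n}" for m
    using nz[OF that] p by (simp add: divide_simps) (simp add: algebra_simps)
  have 1: "(\<Prod>i\<in>{\<kappa><..n}. (v - p3 * z i) / (v - p3 * z i)) = 1"
    by (rule prod.neutral) (use nz \<kappa> in auto)
  have 2: "(\<Prod>i\<in>{1..<\<kappa>}. (z i - 1 / p3 * v) / (z i - 1 / p1 * v)) =
      (\<Prod>i\<in>{1..<\<kappa>}. p1 / p3 * (v - p3 * z i) / (v - p1 * z i))"
    by (rule prod.cong[OF refl], rule ratio) (use \<kappa> in auto)
  have 3: "1 / (2 * of_real pi * \<i> * v) * (v * (z \<kappa> - 1 / p3 * v) / ((z \<kappa> - 1 / p1 * v) * (v - p3 * z \<kappa>)))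
      = p1 / p3 / (2 * of_real pi * \<i> * (v - p1 * z \<kappa>))"
  proof -
    have "1 / (2 * of_real pi * \<i> * v) * (v * (z \<kappa> - 1 / p3 * v) / ((z \<kappa> - 1 / p1 * v) * (v - p3 * z \<kappa>))) =
        ((z \<kappa> - 1 / p3 * v) / (z \<kappa> - 1 / p1 * v)) / (2 * of_real pi * \<i> * (v - p3 * z \<kappa>))"
      using v(1) by simp
    also have "\<dots> = p1 / p3 / (2 * of_real pi * \<i> * (v - p1 * z \<kappa>))"
      unfolding ratio[OF \<kappa>] using nz(2)[OF \<kappa>] by simp
    finally show ?thesis .
  qed
  have 4: "k + 2 - of_int (-1) = k + 3" "- of_int (-1) * (k + 2) = k + 2"
     "- of_int (-1) * (k + 1) - c = k + 1 - c" for c :: complex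
    by simp_all
  show ?thesis
    unfolding variable_factor_def minus_factor_def t_factor_def e1 e3 e2 4 p1_def[symmetric] p3_def[symmetric] 1 2 3
    by simp
qed

lemma kth_in:
  assumes "finite A" "i \<in> {1..card A}"
  shows "kth A i \<in> A"
proof -
  have "sorted_list_of_set A ! (i - 1) \<in> set (sorted_list_of_set A)"
    by (rule nth_mem) (use assms in auto)
  then show ?thesis using assms(1) by (simp add: kth_def)
qed

lemma admissibleD:
  assumes "admissible_contours q k n l \<mu> t z \<gamma>" "i \<in> {1..l}"
  shows "ccw_around_origin (\<gamma> i)"
    and "v \<in> path_image (\<gamma> i) \<Longrightarrow> v \<noteq> 0"
    and "v \<in> path_image (\<gamma> i) \<Longrightarrow> m \<in> {1..n} \<Longrightarrow> v \<noteq> q powr (k + 1) * z m \<and> v \<noteq> q powr (k + 3) * z m"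
proof -
  show c: "ccw_around_origin (\<gamma> i)" using assms by (simp add: admissible_contours_def)
  show "v \<in> path_image (\<gamma> i) \<Longrightarrow> v \<noteq> 0"
    using c inside_no_overlap[of "path_image (\<gamma> i)"] unfolding ccw_around_origin_def by blast
  show "v \<in> path_image (\<gamma> i) \<Longrightarrow> m \<in> {1..n} \<Longrightarrow> v \<noteq> q powr (k + 1) * z m \<and> v \<noteq> q powr (k + 3) * z m"
    using assms unfolding admissible_contours_def by blast
qed

text \<open>For each fixed \<epsilon> the variables of sign 1 are unital: after cancellation their
  poles, including those of the kernels with outer variables, are all inside. They contribute 1
  whatever \<epsilon> is.\<close>

lemma G_eq_minus_integral:
  fixes q k :: complex and \<mu> :: "nat \<Rightarrow> int" and l :: nat
  defines "xs \<equiv> filter (\<lambda>i. \<mu> i = -1) (rev [1..<Suc l])"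
  assumes q: "q \<noteq> 0" and \<nu>: "card {i \<in> {1..n}. \<nu> i = 0} = l"
    and \<mu>: "\<forall>i\<in>{1..l}. \<mu> i \<in> {1, -1}"
    and adm: "admissible_contours q k n l \<mu> t z \<gamma>"
  shows "G q k n l \<nu> \<mu> \<gamma> t z =
    (\<Sum>\<epsilon>\<in>{1..l} \<rightarrow>\<^sub>E {1, -1}. (\<Prod>j\<in>{1..l}. of_int (\<epsilon> j)) * t_prefactor q l \<epsilon> t *
       iterated_integral \<gamma> xs
         (pair_product (\<lambda>_ _ v w. (v - w) / (v - q powr (-2) * w))
           (\<lambda>i v. minus_factor q k (kth (level_set n \<nu> 0) i) z v * t_factor q k l \<epsilon> t v) (set xs)) (\<lambda>_. 0))"
  unfolding G_def
proof (rule sum.cong[OF refl])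
  fix \<epsilon> :: "nat \<Rightarrow> int"
  let ?\<kappa> = "kth (level_set n \<nu> 0)"
  let ?xs = "rev [1..<Suc l]"
  have set: "set ?xs = {1..l}" by auto
  have neg: "\<mu> i = -1" if "i \<in> set xs" for i
    using that unfolding xs_def set_filter by blast
  have \<kappa>: "?\<kappa> i \<in> {1..n}" if "i \<in> {1..l}" for i
    using kth_in[of "level_set n \<nu> 0" i] \<nu> that by (simp add: level_set_def)
  define f where "f i v = (if \<mu> i = -1 then minus_factor q k (?\<kappa> i) z v * t_factor q k l \<epsilon> t v
      else plus_factor q k n l (?\<kappa> i) \<epsilon> t z v)" for i v
  have f: "variable_factor q k n l (?\<kappa> i) (\<mu> i) \<epsilon> t z v = f i v" if "i \<in> {1..l}" "v \<in> path_image (\<gamma> i)" for i v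
  proof (cases "\<mu> i = -1")
    case True
    show ?thesis
      unfolding f_def True
      using variable_factor_minus[OF q \<kappa>[OF that(1)], of v] admissibleD[OF adm that(1)] that(2) by simp
  next
    case False
    then have "\<mu> i = 1" using \<mu> that by auto
    then show ?thesis
      unfolding f_def
      using variable_factor_plus[OF q, of v n, OF _ _ \<kappa>[OF that(1)]] admissibleD[OF adm that(1)] that(2) by simp
  qed
  have unital: "unital_on (\<gamma> i) (f i)" if i: "i \<in> {1..l}" "\<mu> i \<noteq> -1" for i
  proof -
    have m: "\<mu> i = 1" using \<mu> i by auto
    have in3: "q powr (k + 3) * z j \<in> inside (path_image (\<gamma> i))" if "j \<in> {1..n}" for j
      using adm i m that unfolding admissible_contours_def by blast
    have int: "q powr (- (k + 2)) * t a \<in> inside (path_image (\<gamma> i))" if "a \<in> {1..l}" for a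
    proof -
      have "q powr (- of_int (\<mu> i) * (k + 2)) * t a \<in> inside (path_image (\<gamma> i))"
        using adm i that unfolding admissible_contours_def by blast
      then show ?thesis unfolding m by simp
    qed
    have "unital_on (\<gamma> i) (plus_factor q k n l (?\<kappa> i) \<epsilon> t z)"
      unfolding plus_factor_def
      by (intro unital_on_prod unital_on.pole in3 int) (use \<kappa>[OF i(1)] in auto)
    then show ?thesis using i by (simp add: f_def[abs_def])
  qed
  have "multi_contour_integral \<gamma> l (\<lambda>u. (\<Prod>j\<in>{1..l}. 1 / (2 * of_real pi * \<i> * u j)) * G_integrand q k n l \<nu> \<epsilon> \<mu> t z u) (\<lambda>_. 0)
      = t_prefactor q l \<epsilon> t * iterated_integral \<gamma> ?xs
        (pair_product (sign_kernel q \<mu>) (\<lambda>i. variable_factor q k n l (?\<kappa> i) (\<mu> i) \<epsilon> t z) {1..l}) (\<lambda>_. 0)"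
    unfolding multi_contour_integral_eq_iterated integrand_eq_pair_product iterated_integral_cmult ..
  also have "iterated_integral \<gamma> ?xs
        (pair_product (sign_kernel q \<mu>) (\<lambda>i. variable_factor q k n l (?\<kappa> i) (\<mu> i) \<epsilon> t z) {1..l}) (\<lambda>_. 0) =
      iterated_integral \<gamma> ?xs (pair_product (sign_kernel q \<mu>) f (set ?xs)) (\<lambda>_. 0)"
    unfolding set
  proof (rule iterated_integral_cong, rule pair_product_cong[OF _ refl])
    fix v i assume "\<And>i. i \<in> set ?xs \<Longrightarrow> v i \<in> path_image (\<gamma> i)" "i \<in> {1..l}"
    then show "variable_factor q k n l (?\<kappa> i) (\<mu> i) \<epsilon> t z (v i) = f i (v i)"
      using f[of i "v i"] set by blast
  qed
  also have "\<dots> = iterated_integral \<gamma> xs (pair_product (sign_kernel q \<mu>) f (set xs)) (\<lambda>_. 0)"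
    unfolding xs_def
  proof (rule iterated_integral_remove_unital)
    show "sorted_wrt (>) ?xs"
      unfolding sorted_wrt_rev by (metis sorted_wrt_upt)
    show "ccw_around_origin (\<gamma> i)" if "i \<in> set ?xs" for i
      using admissibleD(1)[OF adm] that set by blast
    show "unital_on (\<gamma> i) (f i)" if "i \<in> set ?xs" "\<mu> i \<noteq> -1" for i
      using unital that set by blast
    show "unital_on (\<gamma> i) (\<lambda>v. h v * sign_kernel q \<mu> i j v w)"
      if "i \<in> set ?xs" "j \<in> set ?xs" "i < j" "\<mu> i \<noteq> -1" "w \<in> path_image (\<gamma> j)" "unital_on (\<gamma> i) h" for i j w h
    proof -
      have "i \<in> {1..l}" "j \<in> {i<..l}" using that(1-3) set by auto
      then have "q powr (-2) * w \<in> inside (path_image (\<gamma> i))"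
        using adm that(4,5) unfolding admissible_contours_def by blast
      then show ?thesis
        unfolding sign_kernel_def using that(6) by (intro unital_on.ratio)
    qed
    \<comment> \<open>Signs -1 and 1 give the exponent -2 in the numerator, the same as in the
      denominator.\<close>
    show "sign_kernel q \<mu> i j v w = 1"
      if "i \<in> set ?xs" "j \<in> set ?xs" "i < j" "\<mu> i = -1" "\<mu> j \<noteq> -1" "v \<in> path_image (\<gamma> i)" "w \<in> path_image (\<gamma> j)" for i j v w
    proof -
      have ij: "i \<in> {1..l}" "j \<in> {i<..l}" using that(1-3) set by auto
      then have "q powr (-2) * w \<notin> path_image (\<gamma> i)"
        using adm that(7) unfolding admissible_contours_def by blast
      then have "v - q powr (-2) * w \<noteq> 0" using that(6) by auto
      moreover have "\<mu> j = 1" using \<mu> ij that(5) by auto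
      ultimately show ?thesis using that(4) by (simp add: sign_kernel_def)
    qed
  qed
  \<comment> \<open>Only pairs of equal sign -1 are left, where the exponent of the numerator is
    0.\<close>
  also have "\<dots> = iterated_integral \<gamma> xs (pair_product (\<lambda>_ _ v w. (v - w) / (v - q powr (-2) * w))
           (\<lambda>i v. minus_factor q k (?\<kappa> i) z v * t_factor q k l \<epsilon> t v) (set xs)) (\<lambda>_. 0)"
    by (rule iterated_integral_cong, rule pair_product_cong) (use q neg in \<open>simp_all add: f_def sign_kernel_def\<close>)
  finally show "(\<Prod>j\<in>{1..l}. of_int (\<epsilon> j)) * multi_contour_integral \<gamma> l
      (\<lambda>u. (\<Prod>j\<in>{1..l}. 1 / (2 * of_real pi * \<i> * u j)) * G_integrand q k n l \<nu> \<epsilon> \<mu> t z u) (\<lambda>_. 0) =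
    (\<Prod>j\<in>{1..l}. of_int (\<epsilon> j)) * t_prefactor q l \<epsilon> t * iterated_integral \<gamma> xs
       (pair_product (\<lambda>_ _ v w. (v - w) / (v - q powr (-2) * w))
         (\<lambda>i v. minus_factor q k (?\<kappa> i) z v * t_factor q k l \<epsilon> t v) (set xs)) (\<lambda>_. 0)"
    by simp
qed

section \<open>Vanishing when some sign is 1\<close>

text \<open>The denominators \<open>c\<close> and \<open>d\<close> are independent of \<epsilon>.
  What remains is a Vandermonde product in the q^(\<epsilon>_a) t_a times the product of the values
  of \<open>Q\<close> at q^(-\<epsilon>_a) t_a, where \<open>Q\<close> has degree at most
  \<open>card M\<close>. The same \<open>Q\<close> serves as weight and as null polynomial, and the
  two signs give opposite terms.\<close>

lemma signed_t_sum_zero: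
  fixes v t :: "nat \<Rightarrow> complex" and q k :: complex
  assumes q: "q \<noteq> 0" and M: "finite M" "card M < l"
  shows "(\<Sum>\<epsilon>\<in>{1..l} \<rightarrow>\<^sub>E {1, -1}. (\<Prod>j\<in>{1..l}. of_int (\<epsilon> j)) * t_prefactor q l \<epsilon> t *
     (\<Prod>i\<in>M. t_factor q k l \<epsilon> t (v i))) = 0"
proof -
  define Q where "Q = (\<Prod>i\<in>M. [:v i, - (q powr (k + 1)):])"
  have Q: "poly Q y = (\<Prod>i\<in>M. v i - q powr (k + 1) * y)" for y
    by (simp add: Q_def poly_prod mult.commute)
  have "degree Q \<le> (\<Sum>i\<in>M. degree [:v i, - (q powr (k + 1)):])"
    unfolding Q_def using degree_prod_sum_le[OF M(1), of "\<lambda>i. [:v i, - (q powr (k + 1)):]"] by (simp add: o_def)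
  also have "\<dots> \<le> card M"
    by (rule order_trans[OF sum_bounded_above[of _ _ 1]]) (auto simp: degree_pCons_eq_if)
  finally have dQ: "degree Q < l" using M(2) by simp
  have nzQ: "Q \<noteq> 0"
    unfolding Q_def using M(1) q by simp
  define \<alpha> where "\<alpha> a e = of_int e * poly Q (q powr (- of_int e) * t a)" for a and e :: int
  define y where "y a e = q powr (of_int e) * t a" for a and e :: int
  define c where "c = (\<Prod>a\<in>{1..l}. \<Prod>b\<in>{a<..l}. t b - q powr (-2) * t a)"
  define d where "d = (\<Prod>i\<in>M. \<Prod>a\<in>{1..l}. v i - q powr (k + 2) * t a)"
  have *: "(\<Prod>j\<in>{1..l}. of_int (\<epsilon> j)) * t_prefactor q l \<epsilon> t * (\<Prod>i\<in>M. t_factor q k l \<epsilon> t (v i)) =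
      (\<Prod>a\<in>{1..l}. \<alpha> a (\<epsilon> a)) * (\<Prod>a\<in>{1..l}. \<Prod>b\<in>{a<..l}. y b (\<epsilon> b) - y a (\<epsilon> a)) * (1 / (c * d))" for \<epsilon>
  proof -
    have "(\<Prod>i\<in>M. \<Prod>a\<in>{1..l}. v i - q powr (k + 1 - of_int (\<epsilon> a)) * t a) =
        (\<Prod>a\<in>{1..l}. \<Prod>i\<in>M. v i - q powr (k + 1 - of_int (\<epsilon> a)) * t a)"
      by (rule prod.swap)
    also have "\<dots> = (\<Prod>a\<in>{1..l}. poly Q (q powr (- of_int (\<epsilon> a)) * t a))"
    proof -
      have "q powr (k + 1 - of_int (\<epsilon> a)) = q powr (k + 1) * q powr (- of_int (\<epsilon> a))" for a
        by (simp add: powr_add[symmetric])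
      then show ?thesis by (simp add: Q mult.assoc)
    qed
    finally show ?thesis
      by (simp add: t_prefactor_def t_factor_def prod_dividef \<alpha>_def y_def c_def d_def prod.distrib)
  qed
  have "(\<Sum>\<epsilon>\<in>{1..l} \<rightarrow>\<^sub>E {1, -1}. (\<Prod>a\<in>{1..l}. \<alpha> a (\<epsilon> a)) *
           (\<Prod>a\<in>{1..l}. \<Prod>b\<in>{a<..l}. y b (\<epsilon> b) - y a (\<epsilon> a))) = 0"
    by (rule signed_vandermonde_sum_zero[OF nzQ dQ]) (simp add: \<alpha>_def y_def)
  then show ?thesis
    unfolding * sum_distrib_right[symmetric] by simp
qed

text \<open>A sign 1 makes the number of remaining variables smaller than \<open>l\<close>. Once the
  sum over \<epsilon> stands under the integral, it is 0 at every fixed \<open>u\<close>.\<close>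

lemma G_eq_zero:
  fixes q k :: complex and \<mu> :: "nat \<Rightarrow> int"
  assumes q: "q \<noteq> 0" and \<nu>: "card {i \<in> {1..n}. \<nu> i = 0} = l"
    and \<mu>: "\<forall>i\<in>{1..l}. \<mu> i \<in> {1, -1}" and ex: "\<exists>i\<in>{1..l}. \<mu> i \<noteq> -1"
    and adm: "admissible_contours q k n l \<mu> t z \<gamma>"
  shows "G q k n l \<nu> \<mu> \<gamma> t z = 0"
proof -
  let ?\<kappa> = "kth (level_set n \<nu> 0)"
  define xs where "xs = filter (\<lambda>i. \<mu> i = -1) (rev [1..<Suc l])"
  define M where "M = {i \<in> {1..l}. \<mu> i = -1}"
  have xs: "set xs = M" by (auto simp: xs_def M_def)
  have finM: "finite M" by (simp add: M_def)
  have M: "i \<in> {1..l}" "\<mu> i = -1" if "i \<in> M" for i using that by (auto simp: M_def)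
  have "M \<subset> {1..l}" using ex by (auto simp: M_def)
  then have cM: "card M < l" using psubset_card_mono[of "{1..l}" M] by simp
  have \<kappa>: "?\<kappa> i \<in> {1..n}" if "i \<in> {1..l}" for i
    using kth_in[of "level_set n \<nu> 0" i] \<nu> that by (simp add: level_set_def)
  define K :: "nat \<Rightarrow> nat \<Rightarrow> complex \<Rightarrow> complex \<Rightarrow> complex" where "K = (\<lambda>_ _ v w. (v - w) / (v - q powr (-2) * w))"
  define c where "c \<epsilon> = (\<Prod>j\<in>{1..l}. of_int (\<epsilon> j)) * t_prefactor q l \<epsilon> t" for \<epsilon>
  define F where "F \<epsilon> = pair_product K (\<lambda>i v. minus_factor q k (?\<kappa> i) z v * t_factor q k l \<epsilon> t v) M" for \<epsilon>
  define bad where "bad = (\<lambda>m. q powr (k + 1) * z m) ` {1..n} \<union> (\<lambda>a. q powr (k + 2) * t a) ` {1..l}"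
  define \<Omega> where "\<Omega> = (\<Inter>i\<in>M. {u. u i \<in> - bad}) \<inter> (\<Inter>i\<in>M. \<Inter>j\<in>M \<inter> {i<..}. {u :: nat \<Rightarrow> complex. u i \<noteq> q powr (-2) * u j})"
  have open_\<Omega>: "open \<Omega>"
    unfolding \<Omega>_def
    by (intro open_Int open_INT finM finite_Int disjI1 ballI open_coord_noteq open_coord_in open_Compl finite_imp_closed)
       (simp add: bad_def)
  have F_holo: "cont_holo \<Omega> (F \<epsilon>)" for \<epsilon>
  proof -
    have K: "cont_holo \<Omega> (\<lambda>u. K i j (u i) (u j))" if "i \<in> M" "j \<in> M \<inter> {i<..}" for i j
      unfolding K_def
      by (intro cont_holo_divide cont_holo_diff cont_holo_mult cont_holo_const cont_holo_coord)
         (use that in \<open>auto simp: \<Omega>_def\<close>)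
    have 1: "u i - q powr (k + 1) * z m \<noteq> 0" if "i \<in> M" "m \<in> {1..n}" "u \<in> \<Omega>" for i m u
    proof -
      have "u i \<notin> bad" using that by (simp add: \<Omega>_def)
      moreover have "q powr (k + 1) * z m \<in> bad" unfolding bad_def using that by blast
      ultimately show ?thesis by auto
    qed
    have 2: "u i - q powr (k + 2) * t a \<noteq> 0" if "i \<in> M" "a \<in> {1..l}" "u \<in> \<Omega>" for i a u
    proof -
      have "u i \<notin> bad" using that by (simp add: \<Omega>_def)
      moreover have "q powr (k + 2) * t a \<in> bad" unfolding bad_def using that by blast
      ultimately show ?thesis by auto
    qed
    have "cont_holo \<Omega> (\<lambda>u. minus_factor q k (?\<kappa> i) z (u i))" if i: "i \<in> M" for i
    proof -
      have \<kappa>i: "?\<kappa> i \<in> {1..n}" using \<kappa> M i by blast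
      show ?thesis
        unfolding minus_factor_def
        by (intro cont_holo_mult cont_holo_prod cont_holo_divide cont_holo_diff cont_holo_const cont_holo_coord)
           (use 1[OF i] \<kappa>i in auto)
    qed
    moreover have "cont_holo \<Omega> (\<lambda>u. t_factor q k l \<epsilon> t (u i))" if i: "i \<in> M" for i
      unfolding t_factor_def
      by (intro cont_holo_mult cont_holo_prod cont_holo_divide cont_holo_diff cont_holo_const cont_holo_coord)
         (use 2[OF i] in auto)
    ultimately show ?thesis
      unfolding F_def pair_product_def
      by (intro cont_holo_mult cont_holo_prod K) auto
  qed
  have reach: "(\<lambda>_. 0) \<in> reach \<gamma> xs \<Omega>"
  proof (rule in_reachI)
    fix v assume "\<And>i. i \<in> set xs \<Longrightarrow> v i \<in> path_image (\<gamma> i)"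
    then have v: "v i \<in> path_image (\<gamma> i)" if "i \<in> M" for i using that xs by simp
    show "v \<in> \<Omega>"
      unfolding \<Omega>_def
    proof (intro IntI INT_I)
      fix i assume i: "i \<in> M"
      have "v i \<noteq> q powr (k + 2) * t a" if a: "a \<in> {1..l}" for a
      proof -
        have "q powr (- of_int (\<mu> i) * (k + 2)) * t a \<in> inside (path_image (\<gamma> i))"
          using adm M[OF i] a unfolding admissible_contours_def by blast
        then have "q powr (k + 2) * t a \<in> inside (path_image (\<gamma> i))"
          using M[OF i] by simp
        then show ?thesis
          using v[OF i] inside_no_overlap[of "path_image (\<gamma> i)"] by (metis IntI empty_iff)
      qed
      moreover have "v i \<noteq> q powr (k + 1) * z m" if "m \<in> {1..n}" for m
        using admissibleD(3)[OF adm M(1)[OF i] v[OF i] that] by simp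
      ultimately have "v i \<notin> bad" unfolding bad_def by blast
      then show "v \<in> {u. u i \<in> - bad}" by simp
    next
      fix i j assume i: "i \<in> M" and j: "j \<in> M \<inter> {i<..}"
      then have "i \<in> {1..l}" "j \<in> {i<..l}" "v j \<in> path_image (\<gamma> j)"
        using M[of i] M[of j] v[of j] by auto
      then have "q powr (-2) * v j \<notin> path_image (\<gamma> i)"
        using adm unfolding admissible_contours_def by blast
      then show "v \<in> {u. u i \<noteq> q powr (-2) * u j}"
        using v[OF i] by auto
    qed
  qed
  have path: "valid_path (\<gamma> i) \<and> pathfinish (\<gamma> i) = pathstart (\<gamma> i)" if "i \<in> set xs" for i
    using admissibleD(1)[OF adm, of i] M(1)[of i] that xs by (simp add: ccw_around_origin_def)
  have "G q k n l \<nu> \<mu> \<gamma> t z = (\<Sum>\<epsilon>\<in>{1..l} \<rightarrow>\<^sub>E {1, -1}. c \<epsilon> * iterated_integral \<gamma> xs (F \<epsilon>) (\<lambda>_. 0))"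
    using G_eq_minus_integral[OF q \<nu> \<mu> adm]
    unfolding xs_def[symmetric] xs c_def F_def K_def .
  also have "\<dots> = (\<Sum>\<epsilon>\<in>{1..l} \<rightarrow>\<^sub>E {1, -1}. iterated_integral \<gamma> xs (\<lambda>u. c \<epsilon> * F \<epsilon> u) (\<lambda>_. 0))"
    by (simp add: iterated_integral_cmult)
  also have "\<dots> = iterated_integral \<gamma> xs (\<lambda>u. \<Sum>\<epsilon>\<in>{1..l} \<rightarrow>\<^sub>E {1, -1}. c \<epsilon> * F \<epsilon> u) (\<lambda>_. 0)"
    by (rule iterated_integral_sum[symmetric, OF _ _ open_\<Omega> path reach])
       (auto intro!: finite_PiE cont_holo_mult cont_holo_const F_holo)
  \<comment> \<open>The zero function is written \<open>0 * 0\<close> so that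
    \<open>iterated_integral_cmult\<close> can extract a factor 0.\<close>
  also have "(\<lambda>u. \<Sum>\<epsilon>\<in>{1..l} \<rightarrow>\<^sub>E {1, -1}. c \<epsilon> * F \<epsilon> u) = (\<lambda>u. 0 * 0)"
  proof
    fix u :: "nat \<Rightarrow> complex"
    define B where "B = (\<Prod>i\<in>M. minus_factor q k (?\<kappa> i) z (u i)) * (\<Prod>i\<in>M. \<Prod>j\<in>M \<inter> {i<..}. K i j (u i) (u j))"
    have "c \<epsilon> * F \<epsilon> u = c \<epsilon> * (\<Prod>i\<in>M. t_factor q k l \<epsilon> t (u i)) * B" for \<epsilon>
      by (simp add: F_def pair_product_def prod.distrib B_def)
    then show "(\<Sum>\<epsilon>\<in>{1..l} \<rightarrow>\<^sub>E {1, -1}. c \<epsilon> * F \<epsilon> u) = 0 * 0"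
      using signed_t_sum_zero[OF q finM cM, of t k u]
      by (simp only: c_def sum_distrib_right[symmetric] mult_zero_left)
  qed
  also have "iterated_integral \<gamma> xs (\<lambda>u. 0 * 0) (\<lambda>_. 0) = 0"
    unfolding iterated_integral_cmult by simp
  finally show ?thesis .
qed

section \<open>Evaluation when all signs are -1\<close>

lemma powr_nat_complex:
  fixes q :: complex
  assumes "q \<noteq> 0"
  shows "q powr of_nat m = q ^ m"
proof (induction m)
  case (Suc m)
  have "q powr 1 = q"
    using assms by (simp add: powr_def exp_Ln)
  then show ?case
    unfolding of_nat_Suc powr_add Suc.IH by simp
qed (use assms in simp)

text \<open>Counts the pairs \<open>a < b\<close>; this is the origin of l (l - 1) / 2 in the
  exponent of \<open>q\<close>.\<close>

lemma prod_triangle_const: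
  fixes q :: complex
  assumes q: "q \<noteq> 0"
  shows "(\<Prod>a\<in>{1..l}. \<Prod>b\<in>{a<..l}. q) = q powr (of_nat l * (of_nat l - 1) / 2)"
proof (induction l)
  case (Suc l)
  have "(\<Prod>b\<in>{a<..Suc l}. q) = q * (\<Prod>b\<in>{a<..l}. q)" if "a \<in> {1..l}" for a
  proof -
    have "Suc l - a = Suc (l - a)" using that by auto
    then show ?thesis by simp
  qed
  then have "(\<Prod>a\<in>{1..Suc l}. \<Prod>b\<in>{a<..Suc l}. q) = q ^ l * (\<Prod>a\<in>{1..l}. \<Prod>b\<in>{a<..l}. q)"
    by (simp add: prod.distrib)
  also have "\<dots> = q powr (of_nat l + of_nat l * (of_nat l - 1) / 2)"
    unfolding Suc.IH powr_add powr_nat_complex[OF q] ..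
  also have "of_nat l + of_nat l * (of_nat l - 1) / 2 = (of_nat (Suc l) * (of_nat (Suc l) - 1) / 2 :: complex)"
    by (simp add: field_simps)
  finally show ?case .
qed (use q in simp)

lemma prod_triangle_swap:
  fixes h :: "nat \<Rightarrow> nat \<Rightarrow> 'a::comm_monoid_mult"
  shows "(\<Prod>i\<in>{1..l}. \<Prod>j\<in>{i<..l}. h i j) = (\<Prod>j\<in>{1..l}. \<Prod>i\<in>{1..<j}. h i j)"
proof -
  have "(\<Prod>i\<in>{1..l}. \<Prod>j\<in>{i<..l}. h i j) = (\<Prod>i\<in>{1..l}. \<Prod>j\<in>{j \<in> {1..l}. i < j}. h i j)"
    by (intro prod.cong) auto
  also have "\<dots> = (\<Prod>j\<in>{1..l}. \<Prod>i\<in>{i \<in> {1..l}. i < j}. h i j)"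
    by (rule prod.swap_restrict) auto
  also have "\<dots> = (\<Prod>j\<in>{1..l}. \<Prod>i\<in>{1..<j}. h i j)"
    by (intro prod.cong) auto
  finally show ?thesis .
qed

text \<open>At v = q^(k+2) y every linear factor is q^(k+2) times an expression free of
  \<open>k\<close>. A factor q^(-1) remains from each of the \<open>\<kappa> - 1\<close> quotients,
  one more from 1 - q^(-2) = q^(-1) (q - q^(-1)), and q^(-2) from the prefactor, which together give
  the exponent \<open>- 2 - \<kappa>\<close>.\<close>

lemma minus_factor_at_pole:
  fixes q k y :: complex and \<kappa> :: nat
  assumes q: "q \<noteq> 0" and \<kappa>: "\<kappa> \<ge> 1"
  shows "2 * of_real pi * \<i> * minus_factor q k \<kappa> z (q powr (k + 2) * y) * ((1 - q powr (-2)) * (q powr (k + 2) * y)) =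
    q powr (- 2 - of_nat \<kappa>) * (q - q powr (-1)) *
      (y / (y - q powr (-1) * z \<kappa>) * (\<Prod>j\<in>{1..<\<kappa>}. (q powr (-1) * y - z j) / (y - q powr (-1) * z j)))"
proof -
  define r where "r = q powr (-1)"
  define p where "p = q powr (k + 2)"
  have p: "p \<noteq> 0" and r: "r \<noteq> 0" using q by (simp_all add: p_def r_def)
  have rq: "q * r = 1"
    using q powr_add[of q 1 "-1"] by (simp add: r_def powr_def exp_Ln)
  have e1: "q powr (k + 1) = p * r" unfolding p_def r_def powr_add[symmetric] by (simp add: algebra_simps)
  have r2: "q powr (-2) = r * r" by (simp add: r_def powr_add[symmetric])
  have e3: "r * r * q powr (k + 3) = p * r"
    unfolding p_def r_def powr_add[symmetric] by (simp add: algebra_simps)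
  have P: "q powr (- of_nat \<kappa>) = r ^ \<kappa>"
  proof -
    have "q powr (- of_nat \<kappa>) = 1 / q ^ \<kappa>"
      by (simp add: powr_minus_divide powr_nat_complex[OF q])
    also have "\<dots> = r ^ \<kappa>"
      using rq q by (simp add: divide_eq_eq power_mult_distrib[symmetric] mult.commute)
    finally show ?thesis .
  qed
  have e5: "q powr (- 2 - of_nat \<kappa>) = r * r * r ^ \<kappa>"
    unfolding P[symmetric] by (simp add: r_def powr_add[symmetric])
  have fac: "q powr (-2) * (p * y - q powr (k + 3) * z j) / (p * y - q powr (k + 1) * z j) =
      r * ((r * y - z j) / (y - r * z j))" for j
  proof -
    have "q powr (-2) * (p * y - q powr (k + 3) * z j) = r * r * p * y - (r * r * q powr (k + 3)) * z j"
      unfolding r2 by (simp add: algebra_simps)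
    also have "\<dots> = p * r * (r * y - z j)"
      unfolding e3 by (simp add: algebra_simps)
    finally have "q powr (-2) * (p * y - q powr (k + 3) * z j) = p * r * (r * y - z j)" .
    moreover have "p * y - q powr (k + 1) * z j = p * (y - r * z j)"
      unfolding e1 by (simp add: algebra_simps)
    ultimately show ?thesis using p by simp
  qed
  define D where "D = y - r * z \<kappa>"
  define L where "L = (\<Prod>j\<in>{1..<\<kappa>}. (r * y - z j) / (y - r * z j))"
  have D: "p * y - q powr (k + 1) * z \<kappa> = p * D"
    unfolding e1 D_def by (simp add: algebra_simps)
  have "2 * of_real pi * \<i> * minus_factor q k \<kappa> z (p * y) * ((1 - q powr (-2)) * (p * y)) =
      2 * of_real pi * \<i> * (r * r / (2 * of_real pi * \<i> * (p * D)) * (r ^ (\<kappa> - 1) * L)) * ((1 - r * r) * (p * y))"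
    unfolding minus_factor_def fac prod.distrib D unfolding r2 L_def by simp
  also have "\<dots> = r * r * (1 - r * r) * r ^ (\<kappa> - 1) * (y / D * L)"
    using p by (cases "D = 0") (simp_all add: field_simps)
  also have "r * r * (1 - r * r) * r ^ (\<kappa> - 1) = r * r * r ^ \<kappa> * (q - r)"
  proof -
    have "r ^ \<kappa> = r * r ^ (\<kappa> - 1)" using \<kappa> by (cases \<kappa>) auto
    moreover have "r * (q - r) = 1 - r * r" using rq by (simp add: algebra_simps)
    ultimately show ?thesis by (metis (no_types, lifting) mult.assoc mult.commute)
  qed
  finally show ?thesis
    unfolding e5 D_def L_def r_def[symmetric] p_def[symmetric] .
qed

text \<open>Distinct \<open>t a\<close> make the poles q^(k+2) t_a simple. The constant combines a
  factor \<open>q\<close> from each pair in \<open>t_prefactor\<close> with the factor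
  \<open>c i\<close> from each variable, and the injections of \<open>{1..l}\<close> into itself
  index the sum in \<open>w\<close>.\<close>

lemma G_eq_w:
  fixes q k :: complex and \<mu> :: "nat \<Rightarrow> int"
  assumes q: "q \<noteq> 0" and \<nu>: "card {i \<in> {1..n}. \<nu> i = 0} = l"
    and \<mu>: "\<forall>i\<in>{1..l}. \<mu> i = -1" and inj: "inj_on t {1..l}"
    and adm: "admissible_contours q k n l \<mu> t z \<gamma>"
  shows "G q k n l \<nu> \<mu> \<gamma> t z =
              q powr (- 2 * of_nat l + of_nat l * (of_nat l - 1) / 2
                       - (\<Sum>i\<in>{1..l}. of_nat (kth {i \<in> {1..n}. \<nu> i = 0} i)))
              * (q - q powr (-1)) ^ l
              * w q n l (\<lambda>i. 1 - \<nu> i) t z"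
proof -
  let ?xs = "rev [1..<Suc l]"
  define \<kappa> where "\<kappa> = kth {i \<in> {1..n}. \<nu> i = 0}"
  have level: "level_set n \<nu> 0 = {i \<in> {1..n}. \<nu> i = 0}" "level_set n (\<lambda>i. 1 - \<nu> i) 1 = {i \<in> {1..n}. \<nu> i = 0}"
    by (auto simp: level_set_def)
  have \<kappa>: "\<kappa> i \<in> {1..n}" if "i \<in> {1..l}" for i
    using kth_in[of "{i \<in> {1..n}. \<nu> i = 0}" i] \<nu> that by (simp add: \<kappa>_def)
  have set: "set ?xs = {1..l}" by auto
  have filt: "filter (\<lambda>i. \<mu> i = -1) ?xs = ?xs"
    using \<mu> set by (intro filter_True) blast
  have \<mu>': "\<forall>i\<in>{1..l}. \<mu> i \<in> {1, -1}" using \<mu> by auto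
  define K :: "nat \<Rightarrow> nat \<Rightarrow> complex \<Rightarrow> complex \<Rightarrow> complex" where "K = (\<lambda>_ _ v w. (v - w) / (v - q powr (-2) * w))"
  define x where "x a = q powr (k + 2) * t a" for a
  define s where "s = q powr (-2)"
  have p2: "q powr (k + 2) \<noteq> 0" using q by simp
  have xin: "x a \<in> inside (path_image (\<gamma> i))" if "i \<in> {1..l}" "a \<in> {1..l}" for i a
  proof -
    have "q powr (- of_int (\<mu> i) * (k + 2)) * t a \<in> inside (path_image (\<gamma> i))"
      using adm that unfolding admissible_contours_def by blast
    then show ?thesis using \<mu> that by (simp add: x_def add.commute)
  qed
  define A where "A \<epsilon> = {a \<in> {1..l}. \<epsilon> a = 1}" for \<epsilon> :: "nat \<Rightarrow> int"
  define E where "E \<epsilon> = iterated_integral \<gamma> ?xs (pair_product K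
      (\<lambda>i v. minus_factor q k (\<kappa> i) z v * t_factor q k l \<epsilon> t v) {1..l}) (\<lambda>_. 0)" for \<epsilon>
  have G: "G q k n l \<nu> \<mu> \<gamma> t z =
      (\<Sum>\<epsilon>\<in>{1..l} \<rightarrow>\<^sub>E {1, -1}. (\<Prod>j\<in>{1..l}. of_int (\<epsilon> j)) * t_prefactor q l \<epsilon> t * E \<epsilon>)"
    using G_eq_minus_integral[OF q \<nu> \<mu>' adm] unfolding filt set E_def K_def \<kappa>_def level .
  define Z where "Z = (\<lambda>m. q powr (k + 1) * z m) ` {1..n}"
  have fin: "finite (A \<epsilon>)" for \<epsilon> by (simp add: A_def)
  have "inj_on x {1..l}"
  proof (rule inj_onI)
    fix a b assume ab: "a \<in> {1..l}" "b \<in> {1..l}" "x a = x b"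
    then have "t a = t b" using p2 by (simp add: x_def)
    then show "a = b" using inj_onD[OF inj] ab by blast
  qed
  then have injA: "inj_on x (A \<epsilon>)" for \<epsilon> by (rule inj_on_subset) (auto simp: A_def)
  have ccw: "ccw_around_origin (\<gamma> i)" if "i \<in> {1..l}" for i
    by (rule admissibleD(1)[OF adm that])
  have xinA: "x a \<in> inside (path_image (\<gamma> i))" if "i \<in> {1..l}" "a \<in> A \<epsilon>" for i a \<epsilon>
    by (rule xin) (use that in \<open>auto simp: A_def\<close>)
  have kern: "v \<noteq> s * w" if "i \<in> {1..l}" "j \<in> {1..l}" "i < j" "v \<in> path_image (\<gamma> i)"
      "w \<in> path_image (\<gamma> j) \<union> inside (path_image (\<gamma> j))" for i j v w
  proof
    \<comment> \<open>Solved for the outer variable this is \<open>w = q powr 2 * v\<close>, which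
      the contour condition places outside the contour of index \<open>j\<close>.\<close>
    assume vw: "v = s * w"
    have "q powr 2 * s = 1" unfolding s_def powr_add[symmetric] using q by simp
    then have w: "q powr 2 * v = w" unfolding vw mult.assoc[symmetric] by simp
    have "j \<in> {i<..l}" "\<not> (\<mu> i = -1 \<and> \<mu> j = 1)" using that \<mu> by auto
    then have "q powr 2 * v \<in> outside (path_image (\<gamma> j))"
      using adm that(1,4) unfolding admissible_contours_def by blast
    then show False
      unfolding w using that(5) inside_Un_outside[of "path_image (\<gamma> j)"] inside_Int_outside[of "path_image (\<gamma> j)"] by blast
  qed
  have hol: "open (- Z) \<and>
      minus_factor q k (\<kappa> i) z holomorphic_on - Z \<and>
      path_image (\<gamma> i) \<union> inside (path_image (\<gamma> i)) \<subseteq> - Z"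
    if i: "i \<in> {1..l}" for i
  proof (intro conjI)
    show "open (- Z)"
      by (intro open_Compl finite_imp_closed) (simp add: Z_def)
    have nz: "v - q powr (k + 1) * z m \<noteq> 0" if "m \<in> {1..n}" "v \<in> - Z" for m v
    proof -
      have "v \<noteq> q powr (k + 1) * z m" using that unfolding Z_def by blast
      then show ?thesis by simp
    qed
    show "minus_factor q k (\<kappa> i) z holomorphic_on - Z"
      unfolding minus_factor_def[abs_def]
      by (intro holomorphic_intros) (use nz \<kappa>[OF i] in auto)
    have "q powr (k + 1) * z m \<in> outside (path_image (\<gamma> i))" if "m \<in> {1..n}" for m
      using adm i \<mu> that unfolding admissible_contours_def by blast
    then show "path_image (\<gamma> i) \<union> inside (path_image (\<gamma> i)) \<subseteq> - Z"
      using outside_no_overlap[of "path_image (\<gamma> i)"] inside_Int_outside[of "path_image (\<gamma> i)"]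
      unfolding Z_def by blast
  qed
  have E: "E \<epsilon> = (\<Sum>f\<in>{f \<in> {1..l} \<rightarrow>\<^sub>E A \<epsilon>. inj_on f {1..l}}. \<Prod>i\<in>{1..l}.
      2 * of_real pi * \<i> * minus_factor q k (\<kappa> i) z (x (f i)) * residue_coeff s x (A \<epsilon> - f ` {i..l}) (f i))"
    if \<epsilon>: "\<epsilon> \<in> {1..l} \<rightarrow>\<^sub>E {1, -1}" for \<epsilon>
  proof -
    have "E \<epsilon> = iterated_integral \<gamma> ?xs (pair_product K
      (\<lambda>i v. minus_factor q k (\<kappa> i) z v * (\<Prod>a\<in>A \<epsilon>. (v - s * x a) / (v - x a))) {1..l}) (\<lambda>_. 0)"
      unfolding E_def
    proof (rule iterated_integral_cong, rule pair_product_cong[OF _ refl])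
      fix v i assume v: "\<And>i. i \<in> set ?xs \<Longrightarrow> v i \<in> path_image (\<gamma> i)" and i: "i \<in> {1..l}"
      have vi: "v i \<in> path_image (\<gamma> i)" using v i set by blast
      have nz: "v i - x a \<noteq> 0" if "a \<in> {1..l}" for a
        using xin[OF i that] vi inside_no_overlap[of "path_image (\<gamma> i)"]
        by (metis IntI empty_iff eq_iff_diff_eq_0)
      \<comment> \<open>For \<open>\<epsilon> a = -1\<close> numerator and denominator agree and the
        pole disappears; for \<open>\<epsilon> a = 1\<close> the zero is at q^k t_a, which is
        \<open>s * x a\<close>.\<close>
      have "t_factor q k l \<epsilon> t (v i) = (\<Prod>a\<in>{1..l}. if a \<in> A \<epsilon> then (v i - s * x a) / (v i - x a) else 1)"
        unfolding t_factor_def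
      proof (rule prod.cong[OF refl])
        fix a assume a: "a \<in> {1..l}"
        show "(v i - q powr (k + 1 - of_int (\<epsilon> a)) * t a) / (v i - q powr (k + 2) * t a) =
            (if a \<in> A \<epsilon> then (v i - s * x a) / (v i - x a) else 1)"
        proof (cases "\<epsilon> a = 1")
          case True
          have "s * q powr (k + 2) = q powr k"
            by (simp add: s_def powr_add[symmetric])
          then show ?thesis using True a by (simp add: A_def x_def mult.assoc[symmetric])
        next
          case False
          then have "\<epsilon> a = -1" using PiE_mem[OF \<epsilon> a] by simp
          then show ?thesis using False nz[OF a] by (simp add: A_def x_def add.commute)
        qed
      qed
      also have "\<dots> = (\<Prod>a\<in>A \<epsilon>. (v i - s * x a) / (v i - x a))"
        by (rule prod.mono_neutral_cong_right) (auto simp: A_def)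
      finally show "minus_factor q k (\<kappa> i) z (v i) * t_factor q k l \<epsilon> t (v i) =
          minus_factor q k (\<kappa> i) z (v i) * (\<Prod>a\<in>A \<epsilon>. (v i - s * x a) / (v i - x a))" by simp
    qed
    also have "\<dots> = (\<Sum>f\<in>{f \<in> {1..l} \<rightarrow>\<^sub>E A \<epsilon>. inj_on f {1..l}}. \<Prod>i\<in>{1..l}.
      2 * of_real pi * \<i> * minus_factor q k (\<kappa> i) z (x (f i)) * residue_coeff s x (A \<epsilon> - f ` {i..l}) (f i))"
      unfolding K_def s_def[symmetric]
      by (rule iterated_integral_residues[where x = x and s = s and \<phi> = "\<lambda>i. minus_factor q k (\<kappa> i) z" and S = "\<lambda>_. - Z"])
         (fact fin injA ccw hol xinA kern)+
    finally show ?thesis .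
  qed
  define \<epsilon>1 :: "nat \<Rightarrow> int" where "\<epsilon>1 = restrict (\<lambda>_. 1) {1..l}"
  have \<epsilon>1_eq: "\<epsilon>1 a = 1" if "a \<in> {1..l}" for a
    using that by (simp add: \<epsilon>1_def)
  have "\<epsilon>1 \<in> {1..l} \<rightarrow>\<^sub>E {1, -1}"
    unfolding \<epsilon>1_def restrict_PiE_iff by simp
  moreover have "A \<epsilon>1 = {1..l}"
    unfolding A_def using \<epsilon>1_eq by blast
  ultimately have \<epsilon>1: "\<epsilon>1 \<in> {1..l} \<rightarrow>\<^sub>E {1, -1}" "A \<epsilon>1 = {1..l}" .
  have E0: "E \<epsilon> = 0" if \<epsilon>: "\<epsilon> \<in> {1..l} \<rightarrow>\<^sub>E {1, -1}" "\<epsilon> \<noteq> \<epsilon>1" for \<epsilon>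
  proof -
    have "A \<epsilon> \<noteq> {1..l}"
    proof
      assume "A \<epsilon> = {1..l}"
      then have one: "\<epsilon> a = 1" if "a \<in> {1..l}" for a using that unfolding A_def by blast
      have "\<epsilon> a = \<epsilon>1 a" for a
        using one[of a] PiE_arb[OF \<epsilon>(1), of a] by (cases "a \<in> {1..l}") (simp_all add: \<epsilon>1_def)
      then show False using \<epsilon>(2) by auto
    qed
    then have "A \<epsilon> \<subset> {1..l}" unfolding A_def by blast
    then have "card (A \<epsilon>) < l" using psubset_card_mono[of "{1..l}" "A \<epsilon>"] by simp
    have "\<not> inj_on f {1..l}" if f: "f \<in> {1..l} \<rightarrow>\<^sub>E A \<epsilon>" for f
    proof
      assume "inj_on f {1..l}"
      moreover have "f ` {1..l} \<subseteq> A \<epsilon>" using PiE_mem[OF f] by (rule image_subsetI)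
      ultimately have "card {1..l} \<le> card (A \<epsilon>)" using fin by (rule card_inj_on_le)
      then show False using \<open>card (A \<epsilon>) < l\<close> by simp
    qed
    \<comment> \<open>With fewer than \<open>l\<close> poles available, the sum over residues is
      empty.\<close>
    then have empty: "{f \<in> {1..l} \<rightarrow>\<^sub>E A \<epsilon>. inj_on f {1..l}} = {}" by blast
    show ?thesis unfolding E[OF \<epsilon>(1)] empty by (rule sum.empty)
  qed
  define W where "W f i = t (f i) / (t (f i) - q powr (-1) * z (\<kappa> i))
          * (\<Prod>j\<in>{1..<\<kappa> i}. (q powr (-1) * t (f i) - z j) / (t (f i) - q powr (-1) * z j))" for f i
  define c where "c i = q powr (- 2 - of_nat (\<kappa> i)) * (q - q powr (-1))" for i
  have summand: "(\<Prod>i\<in>{1..l}. 2 * of_real pi * \<i> * minus_factor q k (\<kappa> i) z (x (f i)) * residue_coeff s x ({1..l} - f ` {i..l}) (f i)) =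
      (\<Prod>i\<in>{1..l}. c i) * (\<Prod>i\<in>{1..l}. W f i * (\<Prod>j\<in>{i<..l}. (s * t (f i) - t (f j)) / (t (f i) - t (f j))))"
    if f: "f \<in> {1..l} \<rightarrow>\<^sub>E {1..l}" "inj_on f {1..l}" for f
  proof -
    have "2 * of_real pi * \<i> * minus_factor q k (\<kappa> i) z (x (f i)) * residue_coeff s x ({1..l} - f ` {i..l}) (f i) =
        c i * (W f i * (\<Prod>j\<in>{1..<i}. (s * t (f j) - t (f i)) / (t (f j) - t (f i))))"
      if i: "i \<in> {1..l}" for i
    proof -
      \<comment> \<open>\<open>f\<close> is a permutation, so the points left for variable
        \<open>i\<close> are the images of the smaller indices. Exchanging the two products at the
        end turns these pairs \<open>j < i\<close> into the pairs \<open>i < j\<close> of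
        \<open>w\<close>.\<close>
      have "f ` {1..l} \<subseteq> {1..l}" using f(1) by auto
      then have "f ` {1..l} = {1..l}"
        using f(2) by (intro card_subset_eq) (simp_all add: card_image)
      then have "{1..l} - f ` {i..l} = f ` {1..l} - f ` {i..l}" by simp
      also have "\<dots> = f ` ({1..l} - {i..l})"
        by (rule inj_on_image_set_diff[OF f(2), symmetric]) (use i in auto)
      also have "{1..l} - {i..l} = {1..<i}" using i by auto
      finally have B: "{1..l} - f ` {i..l} = f ` {1..<i}" .
      have inj': "inj_on f {1..<i}" by (rule inj_on_subset[OF f(2)]) (use i in auto)
      \<comment> \<open>The common factor q^(k+2) cancels, which removes \<open>k\<close> from the
        result; negating both differences gives the form used in \<open>w\<close>.\<close>
      have ratio: "(x a - s * x b) / (x a - x b) = (s * t b - t a) / (t b - t a)" for a b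
      proof -
        have "(x a - s * x b) / (x a - x b) = (q powr (k + 2) * (t a - s * t b)) / (q powr (k + 2) * (t a - t b))"
          by (simp add: x_def algebra_simps)
        also have "\<dots> = (s * t b - t a) / (t b - t a)"
          using p2 by (metis minus_diff_eq minus_divide_divide mult_divide_mult_cancel_left)
        finally show ?thesis .
      qed
      have "residue_coeff s x ({1..l} - f ` {i..l}) (f i) =
          (1 - s) * x (f i) * (\<Prod>j\<in>{1..<i}. (s * t (f j) - t (f i)) / (t (f j) - t (f i)))"
        unfolding residue_coeff_def B prod.reindex[OF inj'] o_def ratio ..
      moreover have "2 * of_real pi * \<i> * minus_factor q k (\<kappa> i) z (x (f i)) * ((1 - s) * x (f i)) = c i * W f i"
        using minus_factor_at_pole[OF q, of "\<kappa> i" k z "t (f i)"] \<kappa>[OF i]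
        unfolding x_def s_def c_def W_def by simp
      ultimately show ?thesis by (simp add: mult.assoc[symmetric])
    qed
    then have "(\<Prod>i\<in>{1..l}. 2 * of_real pi * \<i> * minus_factor q k (\<kappa> i) z (x (f i)) * residue_coeff s x ({1..l} - f ` {i..l}) (f i)) =
      (\<Prod>i\<in>{1..l}. c i * (W f i * (\<Prod>j\<in>{1..<i}. (s * t (f j) - t (f i)) / (t (f j) - t (f i)))))"
      by (intro prod.cong refl) blast
    then show ?thesis
      by (simp only: prod.distrib prod_triangle_swap[of "\<lambda>i j. (s * t (f i) - t (f j)) / (t (f i) - t (f j))", symmetric])
  qed
  have pre: "t_prefactor q l \<epsilon>1 t = q powr (of_nat l * (of_nat l - 1) / 2)
      * (\<Prod>a\<in>{1..l}. \<Prod>b\<in>{a<..l}. (t a - t b) / (s * t a - t b))"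
  proof -
    have "t_prefactor q l \<epsilon>1 t = (\<Prod>a\<in>{1..l}. \<Prod>b\<in>{a<..l}. q * ((t a - t b) / (s * t a - t b)))"
      unfolding t_prefactor_def
    proof (intro prod.cong refl)
      fix a b assume "a \<in> {1..l}" "b \<in> {a<..l}"
      then have "\<epsilon>1 a = 1" "\<epsilon>1 b = 1" by (simp_all add: \<epsilon>1_eq)
      moreover have "q powr 1 = q" using powr_nat_complex[OF q, of 1] by simp
      moreover have "(q * t b - q * t a) / (t b - s * t a) = q * ((t a - t b) / (s * t a - t b))"
        by (metis minus_diff_eq minus_divide_divide right_diff_distrib times_divide_eq_right)
      ultimately show "(q powr of_int (\<epsilon>1 b) * t b - q powr of_int (\<epsilon>1 a) * t a) / (t b - q powr (-2) * t a) =
          q * ((t a - t b) / (s * t a - t b))"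
        by (simp add: s_def)
    qed
    then show ?thesis by (simp only: prod.distrib prod_triangle_const[OF q])
  qed
  have C: "(\<Prod>i\<in>{1..l}. c i) = q powr (- 2 * of_nat l - (\<Sum>i\<in>{1..l}. of_nat (\<kappa> i))) * (q - q powr (-1)) ^ l"
  proof -
    have "(\<Prod>i\<in>{1..l}. q powr (- 2 - of_nat (\<kappa> i))) = q powr (\<Sum>i\<in>{1..l}. - 2 - of_nat (\<kappa> i))"
      by (rule powr_sum[OF q, symmetric])
    then show ?thesis
      by (simp add: c_def prod.distrib sum_subtractf mult.commute)
  qed
  have "G q k n l \<nu> \<mu> \<gamma> t z = (\<Prod>j\<in>{1..l}. of_int (\<epsilon>1 j)) * t_prefactor q l \<epsilon>1 t * E \<epsilon>1"
    unfolding G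
    by (subst sum.mono_neutral_right[of _ "{\<epsilon>1}"]) (use \<epsilon>1 E0 in \<open>auto intro!: finite_PiE\<close>)
  also have "(\<Prod>j\<in>{1..l}. of_int (\<epsilon>1 j)) = (1 :: complex)"
    by (rule prod.neutral) (simp add: \<epsilon>1_eq)
  also have "E \<epsilon>1 = (\<Prod>i\<in>{1..l}. c i) * (\<Sum>f\<in>{f \<in> {1..l} \<rightarrow>\<^sub>E {1..l}. inj_on f {1..l}}.
      \<Prod>i\<in>{1..l}. W f i * (\<Prod>j\<in>{i<..l}. (s * t (f i) - t (f j)) / (t (f i) - t (f j))))"
    unfolding E[OF \<epsilon>1(1)] \<epsilon>1(2) sum_distrib_left
    by (rule sum.cong[OF refl], rule summand) auto
  finally have "G q k n l \<nu> \<mu> \<gamma> t z =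
      (q powr (of_nat l * (of_nat l - 1) / 2) * q powr (- 2 * of_nat l - (\<Sum>i\<in>{1..l}. of_nat (\<kappa> i))))
      * (q - q powr (-1)) ^ l * w q n l (\<lambda>i. 1 - \<nu> i) t z"
    unfolding pre C w_def Let_def level(2) W_def s_def \<kappa>_def by (simp only: mult_1_left mult_ac)
  also have "q powr (of_nat l * (of_nat l - 1) / 2) * q powr (- 2 * of_nat l - (\<Sum>i\<in>{1..l}. of_nat (\<kappa> i))) =
      q powr (- 2 * of_nat l + of_nat l * (of_nat l - 1) / 2 - (\<Sum>i\<in>{1..l}. of_nat (\<kappa> i)))"
    unfolding powr_add[symmetric] by (simp add: algebra_simps)
  finally show ?thesis unfolding \<kappa>_def .
qed

theorem theorem1:
  fixes q k :: complex and n l :: nat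
    and \<nu> :: "nat \<Rightarrow> nat" and \<mu> :: "nat \<Rightarrow> int"
    and t z :: "nat \<Rightarrow> complex" and \<gamma> :: "nat \<Rightarrow> real \<Rightarrow> complex"
  assumes "q \<noteq> 0" and "norm q < 1" and "norm (q powr (2 * (k + 2))) < 1"
    and "l \<le> n"
    and "\<forall>i\<in>{1..n}. \<nu> i \<in> {0, 1}"
    and "card {i \<in> {1..n}. \<nu> i = 0} = l"
    and "\<forall>i\<in>{1..l}. \<mu> i \<in> {1, -1}"
    and "\<forall>a\<in>{1..l}. \<forall>b\<in>{a<..l}. t b \<noteq> q powr (-2) * t a"
    and "admissible_contours q k n l \<mu> t z \<gamma>"
  shows "((\<exists>i\<in>{1..l}. \<mu> i \<noteq> -1) \<longrightarrow> G q k n l \<nu> \<mu> \<gamma> t z = 0) \<and>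
         ((\<forall>i\<in>{1..l}. \<mu> i = -1) \<and> inj_on t {1..l} \<longrightarrow>
            G q k n l \<nu> \<mu> \<gamma> t z =
              q powr (- 2 * of_nat l + of_nat l * (of_nat l - 1) / 2
                       - (\<Sum>i\<in>{1..l}. of_nat (kth {i \<in> {1..n}. \<nu> i = 0} i)))
              * (q - q powr (-1)) ^ l
              * w q n l (\<lambda>i. 1 - \<nu> i) t z)"
proof (intro conjI impI)
  assume "\<exists>i\<in>{1..l}. \<mu> i \<noteq> -1"
  then show "G q k n l \<nu> \<mu> \<gamma> t z = 0"
    by (rule G_eq_zero[OF assms(1,6,7) _ assms(9)])
next
  assume "(\<forall>i\<in>{1..l}. \<mu> i = -1) \<and> inj_on t {1..l}"
  then show "G q k n l \<nu> \<mu> \<gamma> t z =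
              q powr (- 2 * of_nat l + of_nat l * (of_nat l - 1) / 2
                       - (\<Sum>i\<in>{1..l}. of_nat (kth {i \<in> {1..n}. \<nu> i = 0} i)))
              * (q - q powr (-1)) ^ l
              * w q n l (\<lambda>i. 1 - \<nu> i) t z"
    by (intro G_eq_w[OF assms(1,6) _ _ assms(9)]) blast+
qed

end
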